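(* Let $(\mathfrak g,\pi,D,\rho,\mu)$ be a pre-LieDer pair with representation space $V$. Then $(\bigoplus_{n=1}^{+\infty}C^n(\mathfrak g,\pi,\rho,\mu,D),\mathcal D)$, with cochain spaces and operator $\mathcal D$ as defined in the context, is a cochain complex, i.e. $\mathcal D\circ\mathcal D=0$.
   Context: All vector spaces are over an algebraically closed field $\mathbb K$ of characteristic $0$. Pre-Lie algebra: a vector space $\mathfrak g$ with a bilinear product $\cdot$ (also denoted $\pi$) such that $(x\cdot y)\cdot z-x\cdot(y\cdot z)=(y\cdot x)\cdot z-y\cdot(x\cdot z)$. Its sub-adjacent Lie algebra $\mathfrak g^C$ has bracket $[x,y]_C=x\cdot y-y\cdot x$. A representation $(V;\rho,\mu)$ consists of a representation $\rho:\mathfrak g\to\mathfrak{gl}(V)$ of the Lie algebra $\mathfrak g^C$ and a linear map $\mu:\mathfrak g\to\mathfrak{gl}(V)$ with $\mu(y)\mu(x)-\mu(x\cdot y)=\mu(y)\rho(x)-\rho(x)\mu(y)$. A pre-LieDer pair $(\mathfrak g,\pi,D,\rho,\mu)$ is a pre-Lie algebra $(\mathfrak g,\pi)$ with a representation $(V;\rho,\mu)$ and a derivation, i.e. a linear map $D:\mathfrak g\to V$ with $D(x\cdot y)=\rho(x)D(y)+\mu(y)D(x)$. We write $\rho(x,v)=\rho(x)v$ and $\mu(v,x)=\mu(x)v$. Matsushima-Nijenhuis bracket: for a vector space $W$, $C^n(W;W)=\mathrm{Hom}(\wedge^{n-1}W\otimes W,W)$, $n\ge1$. For $P\in C^{p+1}(W;W)$,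 $Q\in C^{q+1}(W;W)$, $[P,Q]^{MN}=P\circ Q-(-1)^{pq}Q\circ P$, where $$(P\circ Q)(x_1,\dots,x_{p+q+1})=\sum_{\sigma\in\mathbb S_{(q,1,p-1)}}\mathrm{sgn}(\sigma)P(Q(x_{\sigma(1)},\dots,x_{\sigma(q+1)}),x_{\sigma(q+2)},\dots,x_{\sigma(p+q)},x_{p+q+1})$$ $$+(-1)^{pq}\sum_{\sigma\in\mathbb S_{(p,q)}}\mathrm{sgn}(\sigma)P(x_{\sigma(1)},\dots,x_{\sigma(p)},Q(x_{\sigma(p+1)},\dots,x_{\sigma(p+q)},x_{p+q+1})),$$ with $\mathbb S_{(i_1,\dots,i_k)}$ the unshuffles (first sum absent if $p=0$). It is used for $W=\mathfrak g\oplus V$, with the following maps regarded as elements of $C^*(W;W)$ via horizontal lifts: for $f$ in $\mathrm{Hom}(\wedge^{m-1}\mathfrak g\otimes\mathfrak g,\mathfrak g)$ or $\mathrm{Hom}(\wedge^{m-1}\mathfrak g\otimes\mathfrak g,V)$, $\hat f(x_1+v_1,\dots,x_m+v_m)=f(x_1,\dots,x_m)$; for $f\in\mathrm{Hom}(\wedge^{m-1}\mathfrak g\otimes V,V)$, $\hat f(\dots)=f(x_1,\dots,x_{m-1},v_m)$; for $f\in\mathrm{Hom}(\wedge^{m-2}\mathfrak g\otimes V\otimes\mathfrak g,V)$, $\hat f(\dots)=\sum_{i=1}^{m-1}(-1)^{m-1-i}f(x_1,\dots,\hat{x_i},\dots,x_{m-1},v_i,x_m)$. Cochains: $C^0(\mathfrak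 g,\pi,\rho,\mu,D)=0$, $C^1(\mathfrak g,\pi,\rho,\mu,D)=\mathrm{Hom}(\mathfrak g,\mathfrak g)\oplus\mathrm{Hom}(V,V)$, and for $n\ge2$ $$C^n(\mathfrak g,\pi,\rho,\mu,D)=\mathrm{Hom}(\wedge^{n-1}\mathfrak g\otimes\mathfrak g,\mathfrak g)\oplus\mathrm{Hom}(\wedge^{n-1}\mathfrak g\otimes V,V)\oplus\mathrm{Hom}(\wedge^{n-2}\mathfrak g\otimes V\otimes\mathfrak g,V)\oplus\mathrm{Hom}(\wedge^{n-2}\mathfrak g\otimes\mathfrak g,V).$$ Write an $n$-cochain as $(f,\theta)$ with $f=(f_{\mathfrak g},f_\rho,f_\mu)$ in the first three summands and $\theta$ in the last ($f_\mu=0$, $\theta=0$ when $n=1$); $f$ is identified with the sum of the lifts of its components. The operator $\mathcal D:C^n\to C^{n+1}$ is $\mathcal D(f,\theta)=(-1)^{n-2}l_1^{\alpha}(s^{-1}f,\theta)$, where $l_1^\alpha$ is the first operation of the twisted $L_\infty$-algebra with $\alpha=(s^{-1}(\pi+\rho+\mu),D)$; explicitly (dropping the desuspension $s^{-1}$) $$\mathcal D(f,\theta)=(-1)^{n-2}\big(-[\pi+\rho+\mu,f]^{MN},\ [\pi+\rho+\mu,\theta]^{MN}+[f,D]^{MN}\big).$$ *)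

theory Defs
  imports
    "HOL-Analysis.Product_Vector"
    "HOL-Library.Function_Algebras"
    "HOL-Combinatorics.Permutations"
    "HOL-Computational_Algebra.Polynomial"
begin

section \<open>Pre-LieDer pairs\<close>

locale pre_lie_algebra = vector_space scale
  for scale :: "'k::field \<Rightarrow> 'g::ab_group_add \<Rightarrow> 'g" +
  fixes prd :: "'g \<Rightarrow> 'g \<Rightarrow> 'g"
  assumes prd_linear_left: "\<And>y. Vector_Spaces.linear scale scale (\<lambda>x. prd x y)"
    and prd_linear_right: "\<And>x. Vector_Spaces.linear scale scale (prd x)"
    and pre_lie_identity: "\<And>x y z.
      prd (prd x y) z - prd x (prd y z) = prd (prd y x) z - prd y (prd x z)"

definition sub_adjacent :: "('g \<Rightarrow> 'g \<Rightarrow> 'g::ab_group_add) \<Rightarrow> 'g \<Rightarrow> 'g \<Rightarrow> 'g" where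
  "sub_adjacent prd x y = prd x y - prd y x"

locale pre_lie_representation =
  pre_lie_algebra sg prd + V: vector_space sv
  for sg :: "'k::field \<Rightarrow> 'g::ab_group_add \<Rightarrow> 'g"
    and prd :: "'g \<Rightarrow> 'g \<Rightarrow> 'g"
    and sv :: "'k \<Rightarrow> 'v::ab_group_add \<Rightarrow> 'v" +
  fixes \<rho> \<mu> :: "'g \<Rightarrow> 'v \<Rightarrow> 'v"
  assumes rho_linear: "\<And>x. Vector_Spaces.linear sv sv (\<rho> x)"
    and rho_linear_arg: "\<And>v. Vector_Spaces.linear sg sv (\<lambda>x. \<rho> x v)"
    and mu_linear: "\<And>x. Vector_Spaces.linear sv sv (\<mu> x)"
    and mu_linear_arg: "\<And>v. Vector_Spaces.linear sg sv (\<lambda>x. \<mu> x v)"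
    and rho_bracket: "\<And>x y v. \<rho> (sub_adjacent prd x y) v = \<rho> x (\<rho> y v) - \<rho> y (\<rho> x v)"
    and mu_rho: "\<And>x y v. \<mu> y (\<mu> x v) - \<mu> (prd x y) v = \<mu> y (\<rho> x v) - \<rho> x (\<mu> y v)"

locale pre_LieDer_pair = pre_lie_representation sg prd sv \<rho> \<mu>
  for sg :: "'k::field \<Rightarrow> 'g::ab_group_add \<Rightarrow> 'g"
    and prd :: "'g \<Rightarrow> 'g \<Rightarrow> 'g"
    and sv :: "'k \<Rightarrow> 'v::ab_group_add \<Rightarrow> 'v"
    and \<rho> \<mu> :: "'g \<Rightarrow> 'v \<Rightarrow> 'v" +
  fixes D :: "'g \<Rightarrow> 'v"
  assumes D_linear: "Vector_Spaces.linear sg sv D"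
    and D_derivation: "\<And>x y. D (prd x y) = \<rho> x (D y) + \<mu> y (D x)"

section \<open>Multilinear maps\<close>

text \<open>
  An element of \<open>Hom (\<And>\<^sup>k A \<otimes> B, C)\<close> is a map \<open>P x b\<close>, where \<open>x 0, \<dots>, x (k - 1)\<close> are the
  alternating arguments (indices start at 0) and \<open>b\<close> is the last argument.  The first
  condition says that the remaining values of \<open>x\<close> are irrelevant, so that equality of
  such maps is equality of functions.
\<close>

definition alt_hom ::
  "nat \<Rightarrow> ('k::field \<Rightarrow> 'a::ab_group_add \<Rightarrow> 'a) \<Rightarrow> ('k \<Rightarrow> 'b::ab_group_add \<Rightarrow> 'b) \<Rightarrow>
    ('k \<Rightarrow> 'c::ab_group_add \<Rightarrow> 'c) \<Rightarrow> ((nat \<Rightarrow> 'a) \<Rightarrow> 'b \<Rightarrow> 'c) set" where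
  "alt_hom k sa sb sc = {P.
     (\<forall>x y b. (\<forall>i<k. x i = y i) \<longrightarrow> P x b = P y b) \<and>
     (\<forall>i<k. \<forall>x b. Vector_Spaces.linear sa sc (\<lambda>a. P (x(i := a)) b)) \<and>
     (\<forall>i<k. \<forall>j<k. \<forall>x b. i \<noteq> j \<longrightarrow> x i = x j \<longrightarrow> P x b = 0) \<and>
     (\<forall>x. Vector_Spaces.linear sb sc (P x))}"

text \<open>Elements of \<open>Hom (\<And>\<^sup>k A \<otimes> E \<otimes> B, C)\<close>, written \<open>P x e b\<close>.\<close>

definition alt_hom2 ::
  "nat \<Rightarrow> ('k::field \<Rightarrow> 'a::ab_group_add \<Rightarrow> 'a) \<Rightarrow> ('k \<Rightarrow> 'e::ab_group_add \<Rightarrow> 'e) \<Rightarrow>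
    ('k \<Rightarrow> 'b::ab_group_add \<Rightarrow> 'b) \<Rightarrow> ('k \<Rightarrow> 'c::ab_group_add \<Rightarrow> 'c) \<Rightarrow>
    ((nat \<Rightarrow> 'a) \<Rightarrow> 'e \<Rightarrow> 'b \<Rightarrow> 'c) set" where
  "alt_hom2 k sa se sb sc = {P.
     (\<forall>e. (\<lambda>x b. P x e b) \<in> alt_hom k sa sb sc) \<and>
     (\<forall>x b. Vector_Spaces.linear se sc (\<lambda>e. P x e b))}"

section \<open>The Matsushima-Nijenhuis bracket\<close>

definition unshuffles :: "nat list \<Rightarrow> (nat \<Rightarrow> nat) set" where
  "unshuffles is = {\<sigma>. \<sigma> permutes {..<sum_list is} \<and>
     (\<forall>k<length is. strict_mono_on {sum_list (take k is)..<sum_list (take (Suc k) is)} \<sigma>)}"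

type_synonym 'w cochain = "(nat \<Rightarrow> 'w) \<Rightarrow> 'w \<Rightarrow> 'w"

text \<open>
  \<open>MN_circ s p q P Q\<close> is \<open>P \<circ> Q\<close> for \<open>P \<in> C\<^sup>p\<^sup>+\<^sup>1(W;W)\<close> and \<open>Q \<in> C\<^sup>q\<^sup>+\<^sup>1(W;W)\<close>,
  where \<open>C\<^sup>n(W;W) = alt_hom (n - 1) s s s\<close>.
\<close>

definition MN_circ ::
  "('k::field \<Rightarrow> 'w::ab_group_add \<Rightarrow> 'w) \<Rightarrow> nat \<Rightarrow> nat \<Rightarrow> 'w cochain \<Rightarrow> 'w cochain \<Rightarrow> 'w cochain" where
  "MN_circ s p q P Q = (\<lambda>x w.
     (if p = 0 then 0
      else \<Sum>\<sigma>\<in>unshuffles [q, 1, p - 1]. s (of_int (sign \<sigma>))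
        (P (\<lambda>i. if i = 0 then Q (\<lambda>j. x (\<sigma> j)) (x (\<sigma> q)) else x (\<sigma> (q + i))) w)) +
     s ((- 1) ^ (p * q)) (\<Sum>\<sigma>\<in>unshuffles [p, q]. s (of_int (sign \<sigma>))
        (P (\<lambda>i. x (\<sigma> i)) (Q (\<lambda>j. x (\<sigma> (p + j))) w))))"

definition MN_bracket ::
  "('k::field \<Rightarrow> 'w::ab_group_add \<Rightarrow> 'w) \<Rightarrow> nat \<Rightarrow> nat \<Rightarrow> 'w cochain \<Rightarrow> 'w cochain \<Rightarrow> 'w cochain" where
  "MN_bracket s p q P Q = (\<lambda>x w.
     MN_circ s p q P Q x w - s ((- 1) ^ (p * q)) (MN_circ s q p Q P x w))"

section \<open>Horizontal lifts to the direct sum\<close>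

definition lift_g :: "((nat \<Rightarrow> 'g) \<Rightarrow> 'g \<Rightarrow> 'g) \<Rightarrow> ('g \<times> 'v::zero) cochain" where
  "lift_g f = (\<lambda>x w. (f (\<lambda>i. fst (x i)) (fst w), 0))"

definition lift_gV :: "((nat \<Rightarrow> 'g) \<Rightarrow> 'g \<Rightarrow> 'v) \<Rightarrow> ('g::zero \<times> 'v) cochain" where
  "lift_gV f = (\<lambda>x w. (0, f (\<lambda>i. fst (x i)) (fst w)))"

definition lift_rho :: "((nat \<Rightarrow> 'g) \<Rightarrow> 'v \<Rightarrow> 'v) \<Rightarrow> ('g::zero \<times> 'v) cochain" where
  "lift_rho f = (\<lambda>x w. (0, f (\<lambda>i. fst (x i)) (snd w)))"

text \<open>
  Here \<open>m\<close> is the total number of arguments.  The index \<open>i\<close> counts from 0, whence the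
  exponent \<open>m - 2 - i\<close> instead of \<open>m - 1 - i\<close>.
\<close>

definition lift_mu ::
  "('k::field \<Rightarrow> 'v::ab_group_add \<Rightarrow> 'v) \<Rightarrow> nat \<Rightarrow> ((nat \<Rightarrow> 'g) \<Rightarrow> 'v \<Rightarrow> 'g \<Rightarrow> 'v) \<Rightarrow>
    ('g::zero \<times> 'v) cochain" where
  "lift_mu sv m f = (\<lambda>x w. (0, \<Sum>i<m - 1. sv ((- 1) ^ (m - 2 - i))
     (f (\<lambda>j. if j < i then fst (x j) else fst (x (Suc j))) (snd (x i)) (fst w))))"

section \<open>Cochains and the coboundary operator\<close>

text \<open>The direct sum of Hom spaces, as tuples \<open>(f\<^sub>g, f\<^sub>\<rho>, f\<^sub>\<mu>, \<theta>)\<close>.\<close>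

definition cochain_components ::
  "('k::field \<Rightarrow> 'g::ab_group_add \<Rightarrow> 'g) \<Rightarrow> ('k \<Rightarrow> 'v::ab_group_add \<Rightarrow> 'v) \<Rightarrow> nat \<Rightarrow>
    (((nat \<Rightarrow> 'g) \<Rightarrow> 'g \<Rightarrow> 'g) \<times> ((nat \<Rightarrow> 'g) \<Rightarrow> 'v \<Rightarrow> 'v) \<times>
     ((nat \<Rightarrow> 'g) \<Rightarrow> 'v \<Rightarrow> 'g \<Rightarrow> 'v) \<times> ((nat \<Rightarrow> 'g) \<Rightarrow> 'g \<Rightarrow> 'v)) set" where
  "cochain_components sg sv n =
     (if n = 0 then {(0, 0, 0, 0)}
      else if n = 1 then alt_hom 0 sg sg sg \<times> alt_hom 0 sg sv sv \<times> {0} \<times> {0}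
      else alt_hom (n - 1) sg sg sg \<times> alt_hom (n - 1) sg sv sv \<times>
           alt_hom2 (n - 2) sg sv sg sv \<times> alt_hom (n - 2) sg sg sv)"

definition lift_cochain ::
  "('k::field \<Rightarrow> 'v::ab_group_add \<Rightarrow> 'v) \<Rightarrow> nat \<Rightarrow>
    (((nat \<Rightarrow> 'g::ab_group_add) \<Rightarrow> 'g \<Rightarrow> 'g) \<times> ((nat \<Rightarrow> 'g) \<Rightarrow> 'v \<Rightarrow> 'v) \<times>
     ((nat \<Rightarrow> 'g) \<Rightarrow> 'v \<Rightarrow> 'g \<Rightarrow> 'v) \<times> ((nat \<Rightarrow> 'g) \<Rightarrow> 'g \<Rightarrow> 'v)) \<Rightarrow>
    ('g \<times> 'v) cochain \<times> ('g \<times> 'v) cochain" where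
  "lift_cochain sv n = (\<lambda>(fg, f\<rho>, f\<mu>, \<theta>).
     (lift_g fg + lift_rho f\<rho> + lift_mu sv n f\<mu>, lift_gV \<theta>))"

text \<open>
  The cochain space \<open>C\<^sup>n(\<gg>, \<pi>, \<rho>, \<mu>, D)\<close>.  A cochain \<open>(f, \<theta>)\<close> is identified with its lift;
  nothing is lost by the identification, see \<open>inj_on_lift_cochain\<close> below.
\<close>

definition cochain_space ::
  "('k::field \<Rightarrow> 'g::ab_group_add \<Rightarrow> 'g) \<Rightarrow> ('k \<Rightarrow> 'v::ab_group_add \<Rightarrow> 'v) \<Rightarrow> nat \<Rightarrow>
    (('g \<times> 'v) cochain \<times> ('g \<times> 'v) cochain) set" where
  "cochain_space sg sv n = lift_cochain sv n ` cochain_components sg sv n"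

definition cochain_scale ::
  "('k::field \<Rightarrow> 'g::ab_group_add \<Rightarrow> 'g) \<Rightarrow> ('k \<Rightarrow> 'v::ab_group_add \<Rightarrow> 'v) \<Rightarrow> 'k \<Rightarrow>
    ('g \<times> 'v) cochain \<times> ('g \<times> 'v) cochain \<Rightarrow> ('g \<times> 'v) cochain \<times> ('g \<times> 'v) cochain" where
  "cochain_scale sg sv a = (\<lambda>(F, \<Theta>).
     (\<lambda>x w. module_prod.scale sg sv a (F x w), \<lambda>x w. module_prod.scale sg sv a (\<Theta> x w)))"

definition total_structure ::
  "('k::field \<Rightarrow> 'v::ab_group_add \<Rightarrow> 'v) \<Rightarrow> ('g::ab_group_add \<Rightarrow> 'g \<Rightarrow> 'g) \<Rightarrow>
    ('g \<Rightarrow> 'v \<Rightarrow> 'v) \<Rightarrow> ('g \<Rightarrow> 'v \<Rightarrow> 'v) \<Rightarrow> ('g \<times> 'v) cochain" where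
  "total_structure sv prd \<rho> \<mu> =
     lift_g (\<lambda>x y. prd (x 0) y) + lift_rho (\<lambda>x v. \<rho> (x 0) v) + lift_mu sv 2 (\<lambda>_ v y. \<mu> y v)"

text \<open>
  On an \<open>n\<close>-cochain, \<open>f\<close> has \<open>n\<close> arguments and \<open>\<theta>\<close> has \<open>n - 1\<close>.  The truncated differences only
  matter for \<open>n = 0\<close>, where \<open>f = \<theta> = 0\<close>, and for \<open>n = 1\<close>, where \<open>\<theta> = 0\<close>.
\<close>

definition coboundary ::
  "('k::field \<Rightarrow> 'g::ab_group_add \<Rightarrow> 'g) \<Rightarrow> ('k \<Rightarrow> 'v::ab_group_add \<Rightarrow> 'v) \<Rightarrow>
    ('g \<Rightarrow> 'g \<Rightarrow> 'g) \<Rightarrow> ('g \<Rightarrow> 'v \<Rightarrow> 'v) \<Rightarrow> ('g \<Rightarrow> 'v \<Rightarrow> 'v) \<Rightarrow> ('g \<Rightarrow> 'v) \<Rightarrow> nat \<Rightarrow>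
    ('g \<times> 'v) cochain \<times> ('g \<times> 'v) cochain \<Rightarrow> ('g \<times> 'v) cochain \<times> ('g \<times> 'v) cochain" where
  "coboundary sg sv prd \<rho> \<mu> D n = (\<lambda>(f, \<theta>).
     let sW = module_prod.scale sg sv;
         \<Delta> = total_structure sv prd \<rho> \<mu>;
         D' = lift_gV (\<lambda>_. D)
     in cochain_scale sg sv ((- 1) powi (int n - 2))
          (- MN_bracket sW 1 (n - 1) \<Delta> f,
           MN_bracket sW 1 (n - 2) \<Delta> \<theta> + MN_bracket sW (n - 1) 0 f D'))"

definition cochain_complex ::
  "('k::field \<Rightarrow> 'c::ab_group_add \<Rightarrow> 'c) \<Rightarrow> (nat \<Rightarrow> 'c set) \<Rightarrow> (nat \<Rightarrow> 'c \<Rightarrow> 'c) \<Rightarrow> bool" where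
  "cochain_complex scl C d \<longleftrightarrow>
     vector_space scl \<and>
     (\<forall>n. module.subspace scl (C n)) \<and>
     (\<forall>n. d n ` C n \<subseteq> C (Suc n)) \<and>
     (\<forall>n. \<forall>c\<in>C n. \<forall>c'\<in>C n. d n (c + c') = d n c + d n c') \<and>
     (\<forall>n a. \<forall>c\<in>C n. d n (scl a c) = scl a (d n c)) \<and>
     (\<forall>n. \<forall>c\<in>C n. d (Suc n) (d n c) = 0)"

section \<open>Faithfulness of the lift\<close>

lemma alt_hom_cong:
  assumes "P \<in> alt_hom k sa sb sc" and "\<And>i. i < k \<Longrightarrow> x i = y i"
  shows "P x b = P y b"
  using assms unfolding alt_hom_def by blast

lemma alt_hom_zero:
  assumes "P \<in> alt_hom k sa sb sc"
  shows "P x 0 = 0"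
proof -
  have "Vector_Spaces.linear sb sc (P x)"
    using assms unfolding alt_hom_def by blast
  then interpret Vector_Spaces.linear sb sc "P x" .
  show ?thesis by (rule zero)
qed

lemma alt_hom2_zero:
  assumes "P \<in> alt_hom2 k sa se sb sc"
  shows "P x 0 b = 0" "P x e 0 = 0"
proof -
  have "Vector_Spaces.linear se sc (\<lambda>e. P x e b)"
    using assms unfolding alt_hom2_def by blast
  then interpret Vector_Spaces.linear se sc "\<lambda>e. P x e b" .
  show "P x 0 b = 0" by (rule zero)
  have "(\<lambda>x b. P x e b) \<in> alt_hom k sa sb sc"
    using assms unfolding alt_hom2_def by blast
  from alt_hom_zero[OF this] show "P x e 0 = 0" .
qed

lemma inj_on_lift_cochain:
  fixes sg :: "'k::field \<Rightarrow> 'g::ab_group_add \<Rightarrow> 'g"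
    and sv :: "'k \<Rightarrow> 'v::ab_group_add \<Rightarrow> 'v"
  assumes "vector_space sg" "vector_space sv"
  shows "inj_on (lift_cochain sv n) (cochain_components sg sv n)"
proof (rule inj_onI)
  interpret g: vector_space sg by fact
  interpret V: vector_space sv by fact
  fix c c'
  assume c: "c \<in> cochain_components sg sv n" and c': "c' \<in> cochain_components sg sv n"
    and eq: "lift_cochain sv n c = lift_cochain sv n c'"
  obtain fg f\<rho> f\<mu> \<theta> where cdef: "c = (fg, f\<rho>, f\<mu>, \<theta>)" by (cases c)
  obtain fg' f\<rho>' f\<mu>' \<theta>' where cdef': "c' = (fg', f\<rho>', f\<mu>', \<theta>')" by (cases c')
  have E1: "lift_g fg x w + lift_rho f\<rho> x w + lift_mu sv n f\<mu> x w =
      lift_g fg' x w + lift_rho f\<rho>' x w + lift_mu sv n f\<mu>' x w" for x w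
    using eq unfolding cdef cdef' lift_cochain_def by (cases w) (simp add: fun_eq_iff)
  have E2: "lift_gV \<theta> x w = (lift_gV \<theta>' x w :: 'g \<times> 'v)" for x w
    using eq unfolding cdef cdef' lift_cochain_def by auto
  have th: "\<theta> = \<theta>'"
  proof (intro ext)
    fix x :: "nat \<Rightarrow> 'g" and y :: 'g
    show "\<theta> x y = \<theta>' x y"
      using E2[of "\<lambda>i. (x i, 0)" "(y, 0)"] by (simp add: lift_gV_def)
  qed
  have fg: "fg = fg'"
  proof (intro ext)
    fix x :: "nat \<Rightarrow> 'g" and y :: 'g
    show "fg x y = fg' x y"
      using E1[of "\<lambda>i. (x i, 0)" "(y, 0)"]
      by (simp add: lift_g_def lift_rho_def lift_mu_def)
  qed
  have "f\<rho> = f\<rho>' \<and> f\<mu> = f\<mu>'"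
  proof (cases "n \<le> 1")
    case True
    then have mu: "f\<mu> = 0" "f\<mu>' = 0"
      using c c' unfolding cdef cdef' cochain_components_def by (auto split: if_splits)
    moreover have "f\<rho> x v = f\<rho>' x v" for x v
      using E1[of "\<lambda>i. (x i, 0)" "(0, v)"] mu fg
      by (simp add: lift_g_def lift_rho_def lift_mu_def)
    ultimately show ?thesis by (auto intro!: ext)
  next
    case False
    then have n: "n \<ge> 2" by simp
    have rho: "f\<rho> \<in> alt_hom (n - 1) sg sv sv" "f\<rho>' \<in> alt_hom (n - 1) sg sv sv"
      and mu: "f\<mu> \<in> alt_hom2 (n - 2) sg sv sg sv" "f\<mu>' \<in> alt_hom2 (n - 2) sg sv sg sv"
      using c c' n unfolding cdef cdef' cochain_components_def by (auto split: if_splits)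
    have "f\<rho> x v = f\<rho>' x v" for x v
      using E1[of "\<lambda>i. (x i, 0)" "(0, v)"] fg alt_hom2_zero[OF mu(1)] alt_hom2_zero[OF mu(2)]
      by (simp add: lift_g_def lift_rho_def lift_mu_def)
    then have R: "f\<rho> = f\<rho>'" by (intro ext)
    have "f\<mu> x v y = f\<mu>' x v y" for x v y
    proof -
      define X where "X = (\<lambda>i. if i = n - 2 then (0, v) else (x i, 0::'v))"
      have *: "snd (lift_mu sv n h X (y, 0)) = h x v y"
        if h: "h \<in> alt_hom2 (n - 2) sg sv sg sv" for h
      proof -
        let ?t = "\<lambda>i. sv ((- 1) ^ (n - 2 - i))
          (h (\<lambda>j. if j < i then fst (X j) else fst (X (Suc j))) (snd (X i)) y)"
        have z: "?t i = 0" if "i \<noteq> n - 2" for i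
          using that alt_hom2_zero[OF h] by (simp add: X_def)
        have "(\<Sum>i<n - 1. ?t i) = (\<Sum>i\<in>{n - 2}. ?t i)"
          using n z by (intro sum.mono_neutral_right) auto
        also have "\<dots> = h (\<lambda>j. if j < n - 2 then fst (X j) else fst (X (Suc j))) v y"
          by (simp add: X_def)
        also have "\<dots> = h x v y"
          using h unfolding alt_hom2_def
          by (intro alt_hom_cong[where P = "\<lambda>x b. h x v b" and k = "n - 2"]) (auto simp: X_def)
        finally show ?thesis by (simp add: lift_mu_def)
      qed
      have "lift_mu sv n f\<mu> X (y, 0) = lift_mu sv n f\<mu>' X (y, 0)"
        using E1[of X "(y, 0)"] fg R by simp
      with *[OF mu(1)] *[OF mu(2)] show ?thesis by simp
    qed
    then have "f\<mu> = f\<mu>'" by (intro ext)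
    with R show ?thesis by simp
  qed
  with th fg show "c = c'" unfolding cdef cdef' by simp
qed

end

theory Submission
  imports Defs
begin

text \<open>
  The lifted operator is computed in the semidirect product pre-Lie algebra \<open>W = \<gg> \<oplus> V\<close>, whose product
  is \<open>\<Delta> = \<pi> + \<rho> + \<mu>\<close> and on which \<open>E (x, v) = (0, v)\<close> and \<open>D (x, v) = (0, D x)\<close> are derivations.
  Up to sign \<open>[\<Delta>, f]\<close> is the Chevalley-Eilenberg differential \<open>d f\<close> of the sub-adjacent Lie algebra of
  \<open>W\<close> with values in \<open>Hom (W, W)\<close>, and \<open>[f, D]\<close> is minus the Lie derivative \<open>L\<^sub>D f\<close>.  Cartan's formula
  \<open>\<iota>\<^sub>a d + d \<iota>\<^sub>a = L\<^sub>a\<close> determines \<open>d\<close> recursively in the number of arguments, so that \<open>d\<close> commutes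
  with Lie derivatives along derivations and \<open>d d = 0\<close> by short inductions.  As \<open>E\<close> counts the
  arguments in \<open>V\<close>, the horizontal lifts are exactly the cochains with \<open>L\<^sub>E f = 0\<close> (for \<open>f\<close>) and
  \<open>L\<^sub>E \<theta> = \<theta>\<close> (for \<open>\<theta>\<close>), whence the operator preserves the cochain spaces.
\<close>

section \<open>Shuffles moving a single index\<close>

text \<open>The obstacle is the bracket itself: its graded Jacobi identity in general degrees would
  require nested sums over unshuffles. It can be bypassed, because every bracket in
  \<open>coboundary\<close> has \<open>\<Delta>\<close>, with two arguments, or \<open>D\<close>,
  with one, as a factor. Only unshuffles with a single long block then occur. They are listed
  explicitly, and the lists serve to translate the two kinds of bracket into d and L_D.

  The signs decide the outcome. With q = n - 1 the bracket [\<Delta>, f] is (-1)^q d f, so the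
  prefactor (-1)^(n-2) turns -[\<Delta>, f] into d f. For n >= 2 the operator becomes (f, \<theta>)
  |-> (d f, d \<theta> + (-1)^q L_D f). Its square vanishes because d and L_D commute while the sign
  of the mixed term changes with the degree.

  Weights avoid computing the operator component by component. On a block of a cochain, L_E has the
  eigenvalue e - m, where e is 1 if the output lies in V and 0 otherwise, and m counts the inputs
  from V. In characteristic 0 different integers are different scalars, so the eigenvalue tells
  which blocks can be nonzero.\<close>

definition to_front :: "nat \<Rightarrow> nat \<Rightarrow> nat" where
  "to_front i j = (if j = 0 then i else if j \<le> i then j - 1 else j)"

definition skip :: "nat \<Rightarrow> nat \<Rightarrow> nat" where
  "skip i j = (if j < i then j else Suc j)"

text \<open>Counterpart of \<open>to_front\<close> with the chosen index \<open>i\<close> in slot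
  \<open>q\<close>; the earlier slots list the other indices increasingly, which is what
  \<open>skip i\<close> does.\<close>

definition to_place :: "nat \<Rightarrow> nat \<Rightarrow> nat \<Rightarrow> nat" where
  "to_place q i j = (if j = q then i else if j < q then skip i j else j)"

text \<open>Shifts a permutation past a fixed first index, so that composition with
  \<open>to_front i\<close> chooses \<open>i\<close> first and then permutes the rest.\<close>

definition fix_front :: "(nat \<Rightarrow> nat) \<Rightarrow> nat \<Rightarrow> nat" where
  "fix_front \<sigma> = case_nat 0 (\<lambda>j. Suc (\<sigma> j))"

lemma to_front_0 [simp]: "to_front i 0 = i"
  and to_front_Suc [simp]: "to_front i (Suc j) = skip i j"
  by (auto simp: to_front_def skip_def)

lemma skip_neq: "skip i j \<noteq> i"
  and skip_mono: "j < j' \<Longrightarrow> skip i j < skip i j'"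
  by (auto simp: skip_def)

lemma skip_surj:
  assumes "i \<le> q" "b \<le> q" "b \<noteq> i"
  obtains j where "j < q" "skip i j = b"
proof (cases "b < i")
  case True
  with assms show ?thesis by (intro that[of b]) (auto simp: skip_def)
next
  case False
  with assms show ?thesis by (intro that[of "b - 1"]) (auto simp: skip_def)
qed

lemma fix_front_0 [simp]: "fix_front \<sigma> 0 = 0"
  and fix_front_Suc [simp]: "fix_front \<sigma> (Suc j) = Suc (\<sigma> j)"
  by (auto simp: fix_front_def)

text \<open>A factorisation into adjacent transpositions, each of which contributes a factor -1 to
  the sign.\<close>

lemma to_front_step: "to_front (Suc i) = transpose i (Suc i) \<circ> to_front i"
  by (auto simp: fun_eq_iff to_front_def transpose_def)

lemma fix_front_comp: "fix_front (\<sigma> \<circ> \<tau>) = fix_front \<sigma> \<circ> fix_front \<tau>"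
  by (auto simp: fun_eq_iff fix_front_def split: nat.split)

lemma fix_front_transpose: "fix_front (transpose a b) = transpose (Suc a) (Suc b)"
  by (auto simp: fun_eq_iff fix_front_def transpose_def split: nat.split)

lemma fix_front_id: "fix_front id = id"
  by (auto simp: fun_eq_iff fix_front_def split: nat.split)

lemma to_front_zero: "to_front 0 = id"
  by (auto simp: fun_eq_iff to_front_def)

lemma permutes_to_front: "i \<le> q \<Longrightarrow> to_front i permutes {..q}"
proof (induction i)
  case 0
  show ?case unfolding to_front_zero by (rule permutes_id)
next
  case (Suc i)
  then show ?case
    unfolding to_front_step by (intro permutes_compose permutes_swap_id) auto
qed

lemma permutation_to_front: "permutation (to_front i)"
  using permutes_to_front[of i i] by (auto simp: permutation_permutes)

lemma sign_to_front: "sign (to_front i) = (-1) ^ i"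
proof (induction i)
  case 0
  show ?case unfolding to_front_zero by (simp only: sign_id power_0)
next
  case (Suc i)
  then show ?case
    unfolding to_front_step sign_compose[OF permutation_swap_id permutation_to_front]
    by (simp add: sign_swap_id)
qed

text \<open>\<open>fix_front\<close> is multiplicative and shifts transpositions, so the
  factorisation of \<open>to_front\<close> carries over with the same sign. Both claims share one
  induction, since multiplicativity of the sign needs the permutation property.\<close>

lemma
  shows permutes_fix_front_to_front: "i \<le> q \<Longrightarrow> fix_front (to_front i) permutes {..Suc q}"
    and sign_fix_front_to_front: "sign (fix_front (to_front i)) = (-1) ^ i"
proof -
  have "fix_front (to_front i) permutes {..Suc q} \<and> sign (fix_front (to_front i)) = (-1) ^ i"
    if "i \<le> q" for q using that
  proof (induction i)
    case 0
    show ?case unfolding to_front_zero fix_front_id by (simp only: permutes_id sign_id power_0 simp_thms)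
  next
    case (Suc i)
    then have IH: "fix_front (to_front i) permutes {..Suc q}" "sign (fix_front (to_front i)) = (-1) ^ i"
      by auto
    then have "permutation (fix_front (to_front i))"
      by (auto simp: permutation_permutes)
    with IH have "sign (fix_front (to_front (Suc i))) = (-1) ^ Suc i"
      unfolding to_front_step fix_front_comp fix_front_transpose
      by (simp add: sign_compose[OF permutation_swap_id] sign_swap_id del: o_apply)
    moreover have "fix_front (to_front (Suc i)) permutes {..Suc q}"
      unfolding to_front_step fix_front_comp fix_front_transpose
      using IH Suc.prems by (intro permutes_compose permutes_swap_id) auto
    ultimately show ?case by blast
  qed
  then show "i \<le> q \<Longrightarrow> fix_front (to_front i) permutes {..Suc q}"
    and "sign (fix_front (to_front i)) = (-1) ^ i" by blast+
qed

text \<open>Exhibits \<open>to_place\<close> as a quotient of two \<open>to_front\<close>, which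
  yields the sign (-1)^(i+q) without another induction.\<close>

lemma to_place_eq: "i \<le> q \<Longrightarrow> to_place q i \<circ> to_front q = to_front i"
  by (auto simp: fun_eq_iff to_front_def to_place_def skip_def)

lemma to_place_alt:
  assumes "i \<le> q"
  shows "to_place q i = to_front i \<circ> inv (to_front q)"
proof -
  have "bij (to_front q)"
    using permutes_to_front[of q q] permutes_bij by blast
  then have "to_front q \<circ> inv (to_front q) = id"
    by (metis bij_is_surj surj_iff)
  then show ?thesis
    using to_place_eq[OF assms] by (metis comp_assoc comp_id)
qed

lemma permutes_to_place: "i \<le> q \<Longrightarrow> to_place q i permutes {..q}"
  by (auto simp: to_place_alt intro!: permutes_compose permutes_inv permutes_to_front)

lemma sign_to_place: "i \<le> q \<Longrightarrow> sign (to_place q i) = (-1) ^ (i + q)"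
  by (simp add: to_place_alt sign_compose permutation_to_front permutation_inverse
      sign_inverse sign_to_front power_add)

section \<open>Enumeration of the unshuffles with one long block\<close>

lemma strict_mono_on_unique:
  fixes f g :: "'a::linorder \<Rightarrow> 'b::linorder"
  assumes "finite A" "strict_mono_on A f" "strict_mono_on A g" "f ` A = g ` A" "x \<in> A"
  shows "f x = g x"
proof -
  let ?l = "sorted_list_of_set A"
  have set: "set ?l = A" using assms(1) by simp
  have *: "sorted (map h ?l)" "distinct (map h ?l)" if h: "strict_mono_on A h" for h :: "'a \<Rightarrow> 'b"
  proof -
    show "distinct (map h ?l)"
      using strict_mono_on_imp_inj_on[OF h] by (simp add: distinct_map set)
    show "sorted (map h ?l)"
      unfolding sorted_wrt_map
    proof (rule sorted_wrt_mono_rel)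
      show "sorted ?l" by simp
      show "h x \<le> h y" if "x \<in> set ?l" "y \<in> set ?l" "x \<le> y" for x y
        using strict_mono_on_leD[OF h] that unfolding set by blast
    qed
  qed
  have "map f ?l = map g ?l"
    using *[OF assms(2)] *[OF assms(3)] assms(1,4)
    by (intro sorted_distinct_set_unique) (simp_all only: set set_map)
  then show ?thesis using assms(5) set by (simp add: map_eq_conv)
qed

text \<open>An unshuffle whose other blocks are single slots is determined by its values there:
  agreement off \<open>A\<close> forces equal images of \<open>A\<close>, and a finite set has only
  one increasing enumeration.\<close>

lemma permutes_eqI:
  fixes \<sigma> \<tau> :: "nat \<Rightarrow> nat"
  assumes "\<sigma> permutes S" "\<tau> permutes S" "finite S" "A \<subseteq> S" "\<And>x. x \<in> S - A \<Longrightarrow> \<sigma> x = \<tau> x"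
    and "strict_mono_on A \<sigma>" "strict_mono_on A \<tau>"
  shows "\<sigma> = \<tau>"
proof
  fix x
  have im: "\<upsilon> ` A = S - \<upsilon> ` (S - A)" if "\<upsilon> permutes S" for \<upsilon> :: "nat \<Rightarrow> nat"
    using inj_on_image_set_diff[OF permutes_inj_on[OF that, of S], of S "S - A"] assms(4)
    by (simp add: permutes_image[OF that] double_diff)
  have "\<sigma> ` (S - A) = \<tau> ` (S - A)" using assms(5) by (auto intro: image_cong)
  then have "\<sigma> ` A = \<tau> ` A" using im[OF assms(1)] im[OF assms(2)] by simp
  then have "\<sigma> x = \<tau> x" if "x \<in> A"
    using that assms by (intro strict_mono_on_unique[of A]) (auto intro: finite_subset)
  then show "\<sigma> x = \<tau> x"
    using assms(1,2,5) by (cases "x \<in> S") (auto simp: permutes_not_in)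
qed

lemma unshuffles_2:
  "unshuffles [a, b] = {\<sigma>. \<sigma> permutes {..<a + b} \<and>
     strict_mono_on {..<a} \<sigma> \<and> strict_mono_on {a..<a + b} \<sigma>}"
  by (simp add: unshuffles_def All_less_Suc lessThan_atLeast0 numeral_2_eq_2 conj_ac)

lemma unshuffles_3:
  "unshuffles [a, b, c] = {\<sigma>. \<sigma> permutes {..<a + b + c} \<and>
     strict_mono_on {..<a} \<sigma> \<and> strict_mono_on {a..<a + b} \<sigma> \<and>
     strict_mono_on {a + b..<a + b + c} \<sigma>}"
  by (simp add: unshuffles_def All_less_Suc lessThan_atLeast0 numeral_3_eq_3 add.assoc conj_ac)

lemma unshuffles_0: "unshuffles [0, q] = {id}" "unshuffles [q, 0] = {id}"
proof -
  have "\<sigma> = id" if "\<sigma> permutes {..<q}" "strict_mono_on {..<q} \<sigma>" for \<sigma>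
    using that by (intro permutes_eqI[where S = "{..<q}" and A = "{..<q}"])
      (auto simp: permutes_id strict_mono_on_id)
  then show "unshuffles [0, q] = {id}" "unshuffles [q, 0] = {id}"
    by (auto simp: unshuffles_2 permutes_id strict_mono_on_id lessThan_atLeast0 monotone_on_def)
qed

lemma unshuffles_1_q: "unshuffles [1, q] = to_front ` {..q}" "inj_on to_front {..q}"
proof -
  show "inj_on to_front {..q}" by (metis to_front_0 inj_onI)
  have mono: "strict_mono_on {Suc 0..<Suc q} (to_front i)" for i
  proof (rule strict_mono_onI)
    fix r s assume "r \<in> {Suc 0..<Suc q}" "s \<in> {Suc 0..<Suc q}" "r < s"
    then show "to_front i r < to_front i s" by (cases r; cases s) (auto intro: skip_mono)
  qed
  show "unshuffles [1, q] = to_front ` {..q}"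
  proof (intro equalityI subsetI)
    fix \<sigma> assume "\<sigma> \<in> unshuffles [1, q]"
    then have \<sigma>: "\<sigma> permutes {..q}" "strict_mono_on {Suc 0..<Suc q} \<sigma>"
      by (auto simp: unshuffles_2 lessThan_Suc_atMost)
    then have le: "\<sigma> 0 \<le> q" using permutes_in_image[OF \<sigma>(1), of 0] by simp
    have "\<sigma> = to_front (\<sigma> 0)"
      by (rule permutes_eqI[where S = "{..q}" and A = "{Suc 0..<Suc q}"])
        (use \<sigma> mono permutes_to_front[OF le] in \<open>auto simp: not_le\<close>)
    with le show "\<sigma> \<in> to_front ` {..q}" by auto
  next
    fix \<sigma> assume "\<sigma> \<in> to_front ` {..q}"
    then show "\<sigma> \<in> unshuffles [1, q]"
      using mono permutes_to_front[of _ q]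
      by (auto simp: unshuffles_2 lessThan_Suc_atMost monotone_on_def)
  qed
qed

lemma unshuffles_q_1: "unshuffles [q, 1] = to_place q ` {..q}" "inj_on (to_place q) {..q}"
proof -
  have q: "to_place q i q = i" for i by (simp add: to_place_def)
  then show "inj_on (to_place q) {..q}" by (metis inj_onI)
  have mono: "strict_mono_on {..<q} (to_place q i)" for i
    by (auto intro!: strict_mono_onI skip_mono simp: to_place_def)
  show "unshuffles [q, 1] = to_place q ` {..q}"
  proof (intro equalityI subsetI)
    fix \<sigma> assume "\<sigma> \<in> unshuffles [q, 1]"
    then have \<sigma>: "\<sigma> permutes {..q}" "strict_mono_on {..<q} \<sigma>"
      by (auto simp: unshuffles_2 lessThan_Suc_atMost)
    then have le: "\<sigma> q \<le> q" using permutes_in_image[OF \<sigma>(1), of q] by simp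
    have "\<sigma> = to_place q (\<sigma> q)"
    proof (rule permutes_eqI[where S = "{..q}" and A = "{..<q}"])
      fix x assume "x \<in> {..q} - {..<q}"
      then have "x = q" by auto
      then show "\<sigma> x = to_place q (\<sigma> q) x" by (simp add: q)
    qed (use \<sigma> mono permutes_to_place[OF le] in auto)
    with le show "\<sigma> \<in> to_place q ` {..q}" by auto
  next
    fix \<sigma> assume "\<sigma> \<in> to_place q ` {..q}"
    then show "\<sigma> \<in> unshuffles [q, 1]"
      using mono permutes_to_place[of _ q]
      by (auto simp: unshuffles_2 lessThan_Suc_atMost monotone_on_def)
  qed
qed

text \<open>Empty and one-slot blocks impose no monotonicity. These degenerate shapes come from the
  first sum of \<open>MN_circ\<close> at p = 1 and at q = 0.\<close>

lemma unshuffles_q_1_0: "unshuffles [q, 1, 0] = unshuffles [q, 1]"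
  and unshuffles_0_1_q: "unshuffles [0, 1, q] = unshuffles [1, q]"
  unfolding unshuffles_2 unshuffles_3 by (simp_all add: monotone_on_def)

text \<open>In a pair (i, j), \<open>i\<close> is the first value and \<open>j\<close> the rank of
  the second value among the remaining indices. The first sum of f \<circ> \<Delta> thereby becomes
  a double sum.\<close>

lemma unshuffles_1_1_q:
  "unshuffles [1, 1, q] = (\<lambda>(i, j). to_front i \<circ> fix_front (to_front j)) ` ({..Suc q} \<times> {..q})"
  "inj_on (\<lambda>(i, j). to_front i \<circ> fix_front (to_front j)) ({..Suc q} \<times> {..q})"
proof -
  let ?\<tau> = "\<lambda>i j. to_front i \<circ> fix_front (to_front j)"
  have inj: "i = i' \<and> j = j'" if "?\<tau> i j = ?\<tau> i' j'" for i j i' j'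
  proof -
    have "i = i'" using fun_cong[OF that, of 0] by simp
    moreover have "j = j'"
      using fun_cong[OF that, of "Suc 0"] skip_mono[of j j' i] skip_mono[of j' j i] \<open>i = i'\<close>
      by (cases j j' rule: linorder_cases) auto
    ultimately show ?thesis by simp
  qed
  then show "inj_on (\<lambda>(i, j). ?\<tau> i j) ({..Suc q} \<times> {..q})"
    by (auto simp: inj_on_def)
  have perm: "?\<tau> i j permutes {..Suc q}" if "i \<le> Suc q" "j \<le> q" for i j
    using that by (intro permutes_compose permutes_fix_front_to_front permutes_to_front)
  have mono: "strict_mono_on {Suc (Suc 0)..<Suc (Suc q)} (?\<tau> i j)" for i j
  proof (rule strict_mono_onI)
    fix r s assume *: "r \<in> {Suc (Suc 0)..<Suc (Suc q)}" "s \<in> {Suc (Suc 0)..<Suc (Suc q)}" "r < s"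
    then have rs: "r = Suc (Suc (r - 2))" "s = Suc (Suc (s - 2))" "r - 2 < s - 2" by auto
    then have "skip i (skip j (r - 2)) < skip i (skip j (s - 2))"
      by (intro skip_mono)
    then have "?\<tau> i j (Suc (Suc (r - 2))) < ?\<tau> i j (Suc (Suc (s - 2)))" by simp
    then show "?\<tau> i j r < ?\<tau> i j s" using rs(1,2) by argo
  qed
  show "unshuffles [1, 1, q] = (\<lambda>(i, j). ?\<tau> i j) ` ({..Suc q} \<times> {..q})"
  proof (intro equalityI subsetI)
    fix \<sigma> assume "\<sigma> \<in> unshuffles [1, 1, q]"
    then have \<sigma>: "\<sigma> permutes {..Suc q}" "strict_mono_on {Suc (Suc 0)..<Suc (Suc q)} \<sigma>"
      by (auto simp: unshuffles_3 lessThan_Suc_atMost numeral_2_eq_2)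
    have le: "\<sigma> 0 \<le> Suc q" "\<sigma> (Suc 0) \<le> Suc q"
      using permutes_in_image[OF \<sigma>(1), of 0] permutes_in_image[OF \<sigma>(1), of "Suc 0"] by auto
    have ne: "\<sigma> (Suc 0) \<noteq> \<sigma> 0"
      using permutes_inj[OF \<sigma>(1)] by (metis Zero_neq_Suc injD)
    obtain j where j: "j < Suc q" "skip (\<sigma> 0) j = \<sigma> (Suc 0)"
      using skip_surj[OF le ne] by blast
    have "\<sigma> = ?\<tau> (\<sigma> 0) j"
    proof (rule permutes_eqI[where S = "{..Suc q}" and A = "{Suc (Suc 0)..<Suc (Suc q)}"])
      fix x assume "x \<in> {..Suc q} - {Suc (Suc 0)..<Suc (Suc q)}"
      then have "x = 0 \<or> x = Suc 0" by auto
      then show "\<sigma> x = ?\<tau> (\<sigma> 0) j x" using j by auto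
    qed (use \<sigma> mono perm[OF le(1), of j] j in auto)
    then show "\<sigma> \<in> (\<lambda>(i, j). ?\<tau> i j) ` ({..Suc q} \<times> {..q})"
      using le j by (auto intro!: image_eqI[of _ _ "(\<sigma> 0, j)"])
  next
    fix \<sigma> assume "\<sigma> \<in> (\<lambda>(i, j). ?\<tau> i j) ` ({..Suc q} \<times> {..q})"
    then obtain i j where "\<sigma> = ?\<tau> i j" "i \<le> Suc q" "j \<le> q" by auto
    then show "\<sigma> \<in> unshuffles [1, 1, q]"
      using mono[of i j] perm[of i j]
      by (auto simp: unshuffles_3 lessThan_Suc_atMost numeral_2_eq_2 monotone_on_def)
  qed
qed

section \<open>Alternating maps\<close>

text \<open>Interior product. The value type is left open: the values of a cochain are maps of its
  last argument, and maps with a further distinguished argument are contracted as well.\<close>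

definition ins :: "'a \<Rightarrow> ((nat \<Rightarrow> 'a) \<Rightarrow> 'b) \<Rightarrow> (nat \<Rightarrow> 'a) \<Rightarrow> 'b" where
  "ins a f x = f (case_nat a x)"

lemma ins_head_tail: "f x = ins (x 0) f (\<lambda>i. x (Suc i))"
proof -
  have "case_nat (x 0) (\<lambda>i. x (Suc i)) = x" by (auto simp: fun_eq_iff split: nat.split)
  then show ?thesis by (simp add: ins_def)
qed

lemma ins_add [simp]: "ins a (f + g) = ins a f + ins a g"
  and ins_diff [simp]: "ins a (f - g) = ins a f - ins a g"
  and ins_zero [simp]: "ins a 0 = 0"
  by (auto simp: ins_def fun_eq_iff)

lemma case_nat_upd_0: "(case_nat a x)(0 := b) = case_nat b x"
  and case_nat_upd_Suc: "(case_nat a x)(Suc i := b) = case_nat a (x(i := b))"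
  by (auto simp: fun_eq_iff split: nat.split)

lemma alt_hom_slot_linear:
  assumes "P \<in> alt_hom k sa sb sc" "i < k"
  shows "Vector_Spaces.linear sa sc (\<lambda>a. P (x(i := a)) b)"
  using assms unfolding alt_hom_def by blast

lemma alt_hom_alternating:
  assumes "P \<in> alt_hom k sa sb sc" "i < k" "j < k" "i \<noteq> j" "x i = x j"
  shows "P x b = 0"
  using assms unfolding alt_hom_def by blast

lemma alt_hom_last_linear:
  assumes "P \<in> alt_hom k sa sb sc"
  shows "Vector_Spaces.linear sb sc (P x)"
  using assms unfolding alt_hom_def by blast

lemma linear_simps:
  assumes "Vector_Spaces.linear s1 s2 f"
  shows "f (x + y) = f x + f y" "f (s1 c x) = s2 c (f x)" "f 0 = 0" "f (x - y) = f x - f y" "f (- x) = - f x"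
proof -
  interpret Vector_Spaces.linear s1 s2 f by fact
  show "f (x + y) = f x + f y" "f (s1 c x) = s2 c (f x)" "f 0 = 0" "f (x - y) = f x - f y" "f (- x) = - f x"
    by (rule add scale zero diff neg)+
qed

lemma linear_sum_arg:
  assumes "Vector_Spaces.linear s1 s2 f"
  shows "f (sum g S) = (\<Sum>i\<in>S. f (g i))"
proof -
  interpret Vector_Spaces.linear s1 s2 f by fact
  show ?thesis by (rule sum)
qed

lemma linearI:
  assumes "vector_space s1" "vector_space s2"
    and "\<And>x y. f (x + y) = f x + f y" "\<And>c x. f (s1 c x) = s2 c (f x)"
  shows "Vector_Spaces.linear s1 s2 f"
  using assms by (simp add: Vector_Spaces.linear_iff)

lemma alt_hom_ins:
  assumes "P \<in> alt_hom (Suc k) sa sb sc"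
  shows "ins a P \<in> alt_hom k sa sb sc"
proof -
  have "P (case_nat a x) b = P (case_nat a y) b" if "\<forall>i<k. x i = y i" for x y b
    using that by (intro alt_hom_cong[OF assms]) (auto split: nat.split)
  moreover have "Vector_Spaces.linear sa sc (\<lambda>c. P (case_nat a (x(i := c))) b)" if "i < k" for i x b
    using alt_hom_slot_linear[OF assms, of "Suc i" "case_nat a x"] that by (simp add: case_nat_upd_Suc)
  moreover have "P (case_nat a x) b = 0" if "i < k" "j < k" "i \<noteq> j" "x i = x j" for i j x b
    using alt_hom_alternating[OF assms, of "Suc i" "Suc j" "case_nat a x"] that by simp
  ultimately show ?thesis
    using alt_hom_last_linear[OF assms] unfolding alt_hom_def ins_def by blast
qed

lemma alt_hom_ins_linear:
  assumes "P \<in> alt_hom (Suc k) sa sb sc"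
  shows "Vector_Spaces.linear sa sc (\<lambda>a. ins a P x b)"
  \<comment> \<open>\<open>undefined\<close> stands in the slot that the update overwrites.\<close>
  using alt_hom_slot_linear[OF assms, of 0 "case_nat undefined x"]
  by (simp add: case_nat_upd_0 ins_def)

text \<open>Polarisation: \<open>alt_hom\<close> only demands vanishing on equal entries, so the
  value with x i + x j in both slots is expanded.\<close>

lemma alt_hom_transpose:
  assumes P: "P \<in> alt_hom k sa sb sc" and "i < k" "j < k" "i \<noteq> j"
  shows "P (x \<circ> transpose i j) b = - P x b"
proof -
  define Q where "Q = (\<lambda>u v. P (x(i := u, j := v)) b)"
  have 1: "Q (u + u') v = Q u v + Q u' v" for u u' v
    using linear_simps(1)[OF alt_hom_slot_linear[OF P \<open>i < k\<close>, of "x(j := v)" b]] assms(4)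
    by (simp add: Q_def fun_upd_twist)
  have 2: "Q u (v + v') = Q u v + Q u v'" for u v v'
    using linear_simps(1)[OF alt_hom_slot_linear[OF P \<open>j < k\<close>, of "x(i := u)" b]]
    by (simp add: Q_def)
  have 3: "Q u u = 0" for u
    using alt_hom_alternating[OF P assms(2-4), of "x(i := u, j := u)" b] assms(4)
    by (simp add: Q_def)
  have "Q (x i) (x j) + Q (x j) (x i) = 0"
    using 3[of "x i + x j"] unfolding 1 2 by (simp add: 3 add.commute)
  moreover have "Q (x i) (x j) = P x b" by (simp add: Q_def)
  moreover have "Q (x j) (x i) = P (x \<circ> transpose i j) b"
  proof -
    have "x(i := x j, j := x i) = x \<circ> transpose i j"
      using assms(4) by (auto simp: fun_eq_iff transpose_def)
    then show ?thesis by (simp add: Q_def)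
  qed
  ultimately show ?thesis by (simp add: eq_neg_iff_add_eq_0 add.commute)
qed

lemma alt_hom_permute:
  assumes P: "P \<in> alt_hom k sa sb sc" and "\<sigma> permutes {..<k}"
  shows "P (\<lambda>i. x (\<sigma> i)) b = sc (of_int (sign \<sigma>)) (P x b)"
proof -
  interpret vector_space sc
    using alt_hom_last_linear[OF P] by (simp add: Vector_Spaces.linear_iff)
  have "finite {..<k}" by simp
  from this \<open>\<sigma> permutes {..<k}\<close> have "\<forall>x. P (x \<circ> \<sigma>) b = sc (of_int (sign \<sigma>)) (P x b)"
  proof (induction rule: permutes_rev_induct)
    case id
    show ?case unfolding comp_id sign_id by simp
  next
    case (swap i j p)
    have "permutation p" using swap(4) by (auto simp: permutation_permutes)
    then have sgn: "sign (p \<circ> transpose i j) = - sign p"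
      using swap(3) by (simp only: sign_compose[OF _ permutation_swap_id] sign_swap_id if_False mult_minus_right mult_1_right)
    have "P (x \<circ> (p \<circ> transpose i j)) b = - P (x \<circ> p) b" for x
      unfolding comp_assoc[symmetric] using swap(1-3) by (intro alt_hom_transpose[OF P]) auto
    then show ?case using swap(5) unfolding sgn by (simp del: o_apply)
  qed
  then show ?thesis by (simp add: comp_def)
qed

text \<open>The inductive membership test behind \<open>lie_mem\<close>, \<open>cobd_mem\<close> and
  \<open>insert_alternating_mem\<close>. Alternation is checked in the first two slots only, because
  skew-symmetry of the contraction brings any other slot next to the first. For k = 0 there is no
  second slot and the double contraction need not vanish, hence the guard.\<close>

lemma alt_hom_SucI:
  assumes mem: "\<And>a. ins a P \<in> alt_hom k sa sb sc"
    and lin: "\<And>x b. Vector_Spaces.linear sa sc (\<lambda>a. ins a P x b)"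
    and alt: "\<And>a x b. k > 0 \<Longrightarrow> ins a (ins a P) x b = 0"
  shows "P \<in> alt_hom (Suc k) sa sb sc"
proof -
  have zero: "P x b = 0" if "x 0 = x (Suc j)" "j < k" for x b j
  proof -
    let ?y = "\<lambda>i. x (Suc i)"
    have k: "k > 0" using that by simp
    have *: "ins (x 0) P z b = 0" if "z 0 = x 0" for z
      using alt[OF k, of "x 0" "\<lambda>i. z (Suc i)"] ins_head_tail[of "ins (x 0) P" z] that by simp
    show ?thesis
    proof (cases "j = 0")
      case True
      with that * show ?thesis by (simp add: ins_head_tail[of P x])
    next
      case False
      have "ins (x 0) P (?y \<circ> transpose 0 j) b = - ins (x 0) P ?y b"
        using False that k by (intro alt_hom_transpose[OF mem]) auto
      moreover have "ins (x 0) P (?y \<circ> transpose 0 j) b = 0"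
        using that by (intro *) simp
      ultimately show ?thesis by (simp add: ins_head_tail[of P x])
    qed
  qed
  have "P x b = P y b" if "\<forall>i<Suc k. x i = y i" for x y b
    using that alt_hom_cong[OF mem, of "\<lambda>i. x (Suc i)" "\<lambda>i. y (Suc i)" "y 0"]
    by (simp add: ins_head_tail[of P x] ins_head_tail[of P y])
  moreover have "Vector_Spaces.linear sa sc (\<lambda>a. P (x(i := a)) b)" if "i < Suc k" for i x b
  proof (cases i)
    case 0
    then show ?thesis using lin by (simp add: ins_head_tail[of P "x(0 := _)"])
  next
    case (Suc i')
    then have "(\<lambda>j. (x(i := a)) (Suc j)) = (\<lambda>j. x (Suc j))(i' := a)" for a by auto
    then show ?thesis using Suc that alt_hom_slot_linear[OF mem, of i' "x 0" "\<lambda>j. x (Suc j)" b]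
      by (simp add: ins_head_tail[of P "x(Suc _ := _)"])
  qed
  moreover have "P x b = 0" if "i < Suc k" "j < Suc k" "i \<noteq> j" "x i = x j" for i j x b
  proof (cases "i = 0 \<or> j = 0")
    case True
    with that obtain j' where "x 0 = x (Suc j')" "j' < k"
      by (cases i; cases j; fastforce dest: sym)
    then show ?thesis by (rule zero)
  next
    case False
    then obtain i' j' where "i = Suc i'" "j = Suc j'" by (metis not0_implies_Suc)
    then show ?thesis
      using that alt_hom_alternating[OF mem, of i' j' "\<lambda>j. x (Suc j)"] by (simp add: ins_head_tail[of P x])
  qed
  moreover have "Vector_Spaces.linear sb sc (P x)" for x
    unfolding ins_head_tail[of P x] by (rule alt_hom_last_linear[OF mem])
  ultimately show ?thesis unfolding alt_hom_def by blast
qed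

section \<open>Closure properties of linear and alternating maps\<close>

lemma alt_hom_0_iff:
  "P \<in> alt_hom 0 sa sb sc \<longleftrightarrow> (\<forall>x y. P x = P y) \<and> (\<forall>x. Vector_Spaces.linear sb sc (P x))"
  by (auto simp: alt_hom_def fun_eq_iff)

lemma linear_0:
  assumes "vector_space s1" "vector_space s2" shows "Vector_Spaces.linear s1 s2 (\<lambda>x. 0)"
proof -
  interpret vector_space_pair s1 s2 using assms by (simp add: vector_space_pair_def)
  show ?thesis by (rule module_hom_zero)
qed

lemma linear_add:
  assumes "Vector_Spaces.linear s1 s2 f" "Vector_Spaces.linear s1 s2 g"
  shows "Vector_Spaces.linear s1 s2 (\<lambda>x. f x + g x)"
proof -
  interpret vector_space_pair s1 s2
    using assms by (simp add: Vector_Spaces.linear_iff vector_space_pair_def)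
  show ?thesis using assms by (rule linear_compose_add)
qed

lemma linear_scale:
  assumes "Vector_Spaces.linear s1 s2 f"
  shows "Vector_Spaces.linear s1 s2 (\<lambda>x. s2 c (f x))"
proof -
  interpret vector_space_pair s1 s2
    using assms by (simp add: Vector_Spaces.linear_iff vector_space_pair_def)
  show ?thesis using assms by (rule linear_compose_scale_right)
qed

lemma linear_uminus:
  assumes "Vector_Spaces.linear s1 s2 f"
  shows "Vector_Spaces.linear s1 s2 (\<lambda>x. - f x)"
proof -
  interpret vector_space s2 using assms by (simp add: Vector_Spaces.linear_iff)
  show ?thesis using linear_scale[OF assms, of "-1"] by simp
qed

lemma linear_diff:
  assumes "Vector_Spaces.linear s1 s2 f" "Vector_Spaces.linear s1 s2 g"
  shows "Vector_Spaces.linear s1 s2 (\<lambda>x. f x - g x)"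
  using linear_add[OF assms(1) linear_uminus[OF assms(2)]] by simp

lemma linear_comp:
  assumes "Vector_Spaces.linear s1 s2 f" "Vector_Spaces.linear s2 s3 g"
  shows "Vector_Spaces.linear s1 s3 (\<lambda>x. g (f x))"
  using assms by (simp add: Vector_Spaces.linear_iff)

lemma alt_hom_zero_mem:
  assumes "vector_space sa" "vector_space sb" "vector_space sc"
  shows "0 \<in> alt_hom k sa sb sc"
  using linear_0[OF assms(1,3)] linear_0[OF assms(2,3)] by (simp add: alt_hom_def zero_fun_def)

lemma alt_hom_add:
  assumes P: "P \<in> alt_hom k sa sb sc" and Q: "Q \<in> alt_hom k sa sb sc"
  shows "P + Q \<in> alt_hom k sa sb sc"
proof -
  have "(P + Q) x b = (P + Q) y b" if "\<forall>i<k. x i = y i" for x y b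
    using that alt_hom_cong[OF P, of x y b] alt_hom_cong[OF Q, of x y b] by simp
  moreover have "Vector_Spaces.linear sa sc (\<lambda>a. (P + Q) (x(i := a)) b)" if "i < k" for i x b
    using linear_add[OF alt_hom_slot_linear[OF P that] alt_hom_slot_linear[OF Q that]] by simp
  moreover have "(P + Q) x b = 0" if "i < k" "j < k" "i \<noteq> j" "x i = x j" for i j x b
    using alt_hom_alternating[OF P that] alt_hom_alternating[OF Q that] by simp
  moreover have "Vector_Spaces.linear sb sc ((P + Q) x)" for x
    using linear_add[OF alt_hom_last_linear[OF P] alt_hom_last_linear[OF Q]] by (simp add: plus_fun_def)
  ultimately show ?thesis unfolding alt_hom_def by blast
qed

text \<open>Pullback of the arguments and pushforward of the value at once. The lifts of components
  to the direct sum and the restrictions of a cochain to its components are instances.\<close>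

lemma alt_hom_comp:
  assumes P: "P \<in> alt_hom k sa sb sc"
    and A: "Vector_Spaces.linear sa' sa A" and B: "Vector_Spaces.linear sb' sb B"
    and C: "Vector_Spaces.linear sc sc' C"
  shows "(\<lambda>x b. C (P (\<lambda>i. A (x i)) (B b))) \<in> alt_hom k sa' sb' sc'"
proof -
  have upd: "(\<lambda>j. A ((x(i := a)) j)) = (\<lambda>j. A (x j))(i := A a)" for x i a by auto
  have "C (P (\<lambda>i. A (x i)) (B b)) = C (P (\<lambda>i. A (y i)) (B b))" if "\<forall>i<k. x i = y i" for x y b
    using that by (intro arg_cong[where f = C] alt_hom_cong[OF P]) auto
  moreover have "Vector_Spaces.linear sa' sc' (\<lambda>a. C (P (\<lambda>j. A ((x(i := a)) j)) (B b)))"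
    if "i < k" for i x b
    unfolding upd using alt_hom_slot_linear[OF P that] A C by (intro linear_comp[OF _ C] linear_comp[OF A])
  moreover have "C (P (\<lambda>i. A (x i)) (B b)) = 0" if "i < k" "j < k" "i \<noteq> j" "x i = x j" for i j x b
    using that alt_hom_alternating[OF P that(1-3), of "\<lambda>i. A (x i)"] linear_simps(3)[OF C] by simp
  moreover have "Vector_Spaces.linear sb' sc' (\<lambda>b. C (P (\<lambda>i. A (x i)) (B b)))" for x
    by (intro linear_comp[OF _ C] linear_comp[OF B] alt_hom_last_linear[OF P])
  ultimately show ?thesis unfolding alt_hom_def by blast
qed

lemma linear_identity: "vector_space s \<Longrightarrow> Vector_Spaces.linear s s (\<lambda>x. x)"
  by (simp add: Vector_Spaces.linear_iff)

lemma alt_hom_scale: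
  assumes "vector_space sa" and P: "P \<in> alt_hom k sa sb sc"
  shows "(\<lambda>x b. sc c (P x b)) \<in> alt_hom k sa sb sc"
proof -
  have sb: "vector_space sb" and sc: "vector_space sc"
    using alt_hom_last_linear[OF P] by (simp_all add: Vector_Spaces.linear_iff)
  show ?thesis
    by (rule alt_hom_comp[OF P linear_identity[OF assms(1)] linear_identity[OF sb] linear_scale[OF linear_identity[OF sc]]])
qed

lemma alt_hom_uminus:
  assumes "vector_space sa" and P: "P \<in> alt_hom k sa sb sc"
  shows "- P \<in> alt_hom k sa sb sc"
proof -
  interpret vector_space sc
    using alt_hom_last_linear[OF P] by (simp add: Vector_Spaces.linear_iff)
  show ?thesis using alt_hom_scale[OF assms, of "-1"] by (simp add: fun_Compl_def)
qed

lemma alt_hom_diff: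
  assumes "vector_space sa" "P \<in> alt_hom k sa sb sc" "Q \<in> alt_hom k sa sb sc"
  shows "P - Q \<in> alt_hom k sa sb sc"
  using alt_hom_add[OF assms(2) alt_hom_uminus[OF assms(1,3)]] by simp

lemma alt_hom_ins_ins_same:
  assumes "P \<in> alt_hom (Suc (Suc k)) sa sb sc"
  shows "ins a (ins a P) = 0"
  using alt_hom_alternating[OF assms, of 0 "Suc 0"] by (auto simp: ins_def fun_eq_iff)

lemma alt_hom_ins_ins:
  assumes P: "P \<in> alt_hom (Suc (Suc k)) sa sb sc"
  shows "ins a (ins b P) = - ins b (ins a P)"
proof (intro ext)
  fix x c
  have "case_nat b (case_nat a x) = case_nat a (case_nat b x) \<circ> transpose 0 (Suc 0)"
    by (auto simp: fun_eq_iff transpose_def split: nat.split)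
  then show "ins a (ins b P) x c = (- ins b (ins a P)) x c"
    using alt_hom_transpose[OF P, of 0 "Suc 0" "case_nat a (case_nat b x)" c]
    by (simp add: ins_def)
qed

section \<open>Lie derivatives and the differential\<close>

text \<open>
  The Lie derivative of a map with \<open>q\<close> alternating arguments along \<open>T\<close>, where \<open>\<tau>\<close> is the
  action on the values, these being maps of the last argument.
\<close>

definition lie :: "nat \<Rightarrow> ('a \<Rightarrow> 'a) \<Rightarrow> ('b \<Rightarrow> 'b) \<Rightarrow> ((nat \<Rightarrow> 'a) \<Rightarrow> 'b) \<Rightarrow> (nat \<Rightarrow> 'a) \<Rightarrow> 'b::ab_group_add" where
  "lie q T \<tau> f x = \<tau> (f x) - (\<Sum>j<q. f (x(j := T (x j))))"

lemma sum_fun_apply: "(sum g S) x = (\<Sum>i\<in>S. g i x)"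
  by (induction S rule: infinite_finite_induct) simp_all

text \<open>Abstracts the step of \<open>lie_lie\<close>: a - b = c is the induction hypothesis, and
  the mixed terms p and q, Lie derivatives of contractions, cancel. The next two identities do the
  same for \<open>cobd_lie\<close>.\<close>

lemma diff_commutator_eq:
  fixes a b c p q r s :: "'a::ab_group_add"
  assumes "a - b = c"
  shows "a - p - (q - r) - (b - q - (p - s)) = c - (s - r)"
  unfolding assms[symmetric] by (simp add: algebra_simps)

lemma commutator_shift_eq:
  fixes a b c p q :: "'a::ab_group_add"
  assumes "a - b = c"
  shows "a - p - (c - q) = b - (p - q)"
  unfolding assms[symmetric] by (simp add: algebra_simps)

lemma diff_eq_swap:
  fixes a b c :: "'a::ab_group_add"
  assumes "a - b = c"
  shows "a - c = b"
  unfolding assms[symmetric] by (simp add: algebra_simps)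

text \<open>No degree or linearity is assumed, since every sequence has a head and a tail.
  Identities between operators on cochains thus reduce to their commutation rules with
  \<open>ins\<close>.\<close>

lemma eq_if_ins_eq:
  assumes "\<And>a. ins a f = ins a g" shows "f = g"
  using assms by (intro ext) (metis ins_head_tail)

text \<open>Cartan's rule for the commutator of a Lie derivative with a contraction; the summand of
  index 0 supplies the contraction with T a.\<close>

lemma ins_lie:
  "ins a (lie (Suc q) T \<tau> f) = lie q T \<tau> (ins a f) - ins (T a) f"
  by (rule ext) (simp add: lie_def ins_def sum.lessThan_Suc_shift case_nat_upd_0 case_nat_upd_Suc
      del: sum.lessThan_Suc)

lemma lie_0: "lie 0 T \<tau> f x = \<tau> (f x)"
  by (simp add: lie_def)

context pre_lie_algebra
begin

abbreviation endo :: "('g \<Rightarrow> 'g) \<Rightarrow> bool" where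
  "endo \<equiv> Vector_Spaces.linear scale scale"

abbreviation cochains :: "nat \<Rightarrow> ((nat \<Rightarrow> 'g) \<Rightarrow> 'g \<Rightarrow> 'g) set" where
  "cochains q \<equiv> alt_hom q scale scale scale"

text \<open>Linearity is asked on all functions, not only on endomorphisms, so that
  \<open>lie_add\<close> and its companions hold without a membership hypothesis.\<close>

definition operator :: "(('g \<Rightarrow> 'g) \<Rightarrow> 'g \<Rightarrow> 'g) \<Rightarrow> bool" where
  "operator \<tau> \<longleftrightarrow> (\<forall>\<phi> \<psi>. \<tau> (\<phi> + \<psi>) = \<tau> \<phi> + \<tau> \<psi>) \<and>
     (\<forall>c \<phi>. \<tau> (\<lambda>w. scale c (\<phi> w)) = (\<lambda>w. scale c (\<tau> \<phi> w))) \<and>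
     (\<forall>\<phi>. endo \<phi> \<longrightarrow> endo (\<tau> \<phi>))"

lemma operator_simps:
  assumes "operator \<tau>"
  shows "\<tau> (\<phi> + \<psi>) = \<tau> \<phi> + \<tau> \<psi>" "\<tau> (\<lambda>w. scale c (\<phi> w)) = (\<lambda>w. scale c (\<tau> \<phi> w))"
    "\<tau> 0 = 0" "\<tau> (- \<phi>) = - \<tau> \<phi>" "\<tau> (\<phi> - \<psi>) = \<tau> \<phi> - \<tau> \<psi>"
proof -
  show 1: "\<tau> (\<phi> + \<psi>) = \<tau> \<phi> + \<tau> \<psi>" "\<tau> (\<lambda>w. scale c (\<phi> w)) = (\<lambda>w. scale c (\<tau> \<phi> w))" for \<phi> \<psi> c
    using assms by (simp_all add: operator_def)
  show 2: "\<tau> 0 = 0" using 1(1)[of 0 0] by simp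
  show 3: "\<tau> (- \<phi>) = - \<tau> \<phi>" for \<phi> using 1(1)[of \<phi> "- \<phi>"] 2 by (simp add: eq_neg_iff_add_eq_0 add.commute)
  show "\<tau> (\<phi> - \<psi>) = \<tau> \<phi> - \<tau> \<psi>" using 1(1)[of \<phi> "- \<psi>"] 3 by simp
qed

lemma operator_endo: "operator \<tau> \<Longrightarrow> endo \<phi> \<Longrightarrow> endo (\<tau> \<phi>)"
  by (simp add: operator_def)

lemma lie_add:
  assumes "operator \<tau>" shows "lie q T \<tau> (f + g) = lie q T \<tau> f + lie q T \<tau> g"
  by (rule ext) (simp add: lie_def operator_simps[OF assms] sum.distrib)

lemma lie_diff:
  assumes "operator \<tau>" shows "lie q T \<tau> (f - g) = lie q T \<tau> f - lie q T \<tau> g"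
  by (rule ext) (simp add: lie_def operator_simps[OF assms] sum_subtractf)

lemma lie_zero:
  assumes "operator \<tau>" shows "lie q T \<tau> 0 = 0"
  by (rule ext) (simp add: lie_def operator_simps[OF assms])

lemma lie_scale:
  assumes "operator \<tau>"
  shows "lie q T \<tau> (\<lambda>x w. scale c (f x w)) = (\<lambda>x w. scale c (lie q T \<tau> f x w))"
  by (intro ext) (simp add: lie_def operator_simps[OF assms] sum_fun_apply scale_right_diff_distrib scale_sum_right)

lemma cochains_cong: "f \<in> cochains q \<Longrightarrow> (\<And>i. i < q \<Longrightarrow> x i = y i) \<Longrightarrow> f x = f y"
  using alt_hom_cong by blast

lemma lie_mem:
  assumes T: "endo T" and \<tau>: "operator \<tau>" and "f \<in> cochains q"
  shows "lie q T \<tau> f \<in> cochains q"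
  using assms(3)
proof (induction q arbitrary: f)
  case 0
  then show ?case by (simp add: alt_hom_0_iff lie_0 operator_endo[OF \<tau>]) metis
next
  case (Suc q)
  show ?case
  proof (rule alt_hom_SucI)
    show "ins a (lie (Suc q) T \<tau> f) \<in> cochains q" for a
      unfolding ins_lie by (intro alt_hom_diff Suc.IH alt_hom_ins Suc.prems vector_space_axioms)
    show "endo (\<lambda>a. ins a (lie (Suc q) T \<tau> f) x b)" for x b
    proof -
      note lin = linear_simps[OF alt_hom_ins_linear[OF Suc.prems]]
      have "ins (a + c) f = ins a f + ins c f" for a c by (simp add: fun_eq_iff lin)
      moreover have "ins (scale c a) f = (\<lambda>x w. scale c (ins a f x w))" for a c by (simp add: fun_eq_iff lin)
      ultimately have "endo (\<lambda>a. lie q T \<tau> (ins a f) x b)"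
        by (intro linearI vector_space_axioms) (simp_all add: lie_add[OF \<tau>] lie_scale[OF \<tau>])
      moreover have "endo (\<lambda>a. ins (T a) f x b)"
        using linear_comp[OF T alt_hom_ins_linear[OF Suc.prems]] .
      ultimately show ?thesis by (simp add: ins_lie linear_diff)
    qed
    show "ins a (ins a (lie (Suc q) T \<tau> f)) x b = 0" if "q > 0" for a x b
    proof -
      obtain q' where q: "q = Suc q'" using \<open>q > 0\<close> by (cases q) auto
      with Suc.prems have f: "f \<in> cochains (Suc (Suc q'))" by simp
      show ?thesis
        unfolding q ins_lie ins_diff alt_hom_ins_ins_same[OF f] lie_zero[OF \<tau>]
        using alt_hom_ins_ins[OF f, of a "T a"] by simp
    qed
  qed
qed

text \<open>[L_T, L_S] = L_[T,S], with both commutators given as hypotheses. The one on values is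
  asked for endomorphisms only, where \<open>act_act\<close> and
  \<open>derivation_action_act\<close> provide it.\<close>

lemma lie_lie:
  assumes \<tau>: "operator \<tau>" and \<sigma>: "operator \<sigma>" and "f \<in> cochains q" and "endo S" "endo T"
    and \<upsilon>: "\<And>\<phi>. endo \<phi> \<Longrightarrow> \<tau> (\<sigma> \<phi>) - \<sigma> (\<tau> \<phi>) = \<upsilon> \<phi>"
    and U: "\<And>a. T (S a) - S (T a) = U a"
  shows "lie q T \<tau> (lie q S \<sigma> f) - lie q S \<sigma> (lie q T \<tau> f) = lie q U \<upsilon> f"
  using assms(3)
proof (induction q arbitrary: f)
  case 0
  then show ?case by (auto simp: alt_hom_0_iff lie_0 fun_eq_iff \<upsilon>[symmetric])
next
  case (Suc q)
  note lin = linear_simps[OF alt_hom_ins_linear[OF Suc.prems]]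
  have U': "ins (U a) f = ins (T (S a)) f - ins (S (T a)) f" for a
    by (simp add: fun_eq_iff U[symmetric] lin)
  have "ins a (lie (Suc q) T \<tau> (lie (Suc q) S \<sigma> f) - lie (Suc q) S \<sigma> (lie (Suc q) T \<tau> f)) =
      ins a (lie (Suc q) U \<upsilon> f)" for a
    unfolding ins_diff ins_lie lie_diff[OF \<tau>] lie_diff[OF \<sigma>] U'
      diff_commutator_eq[OF Suc.IH[OF alt_hom_ins[OF Suc.prems]]] by (rule refl)
  then show ?case by (rule eq_if_ins_eq)
qed

section \<open>Actions of derivations and of algebra elements on Hom (W, W)\<close>

definition derivation_action :: "('g \<Rightarrow> 'g) \<Rightarrow> ('g \<Rightarrow> 'g) \<Rightarrow> 'g \<Rightarrow> 'g" where
  "derivation_action T \<phi> w = T (\<phi> w) - \<phi> (T w)"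

lemma operator_derivation_action: "endo T \<Longrightarrow> operator (derivation_action T)"
proof -
  assume T: "endo T"
  have "endo (derivation_action T \<phi>)" if "endo \<phi>" for \<phi>
    unfolding derivation_action_def[abs_def]
    using T that by (intro linear_diff linear_comp[OF that T] linear_comp[OF T that])
  then show ?thesis
    by (simp add: operator_def fun_eq_iff derivation_action_def linear_simps[OF T]
        scale_right_diff_distrib algebra_simps)
qed

abbreviation ad :: "'g \<Rightarrow> 'g \<Rightarrow> 'g" where
  "ad \<equiv> sub_adjacent prd"

text \<open>The commutator of \<open>\<phi>\<close> with left multiplication by \<open>x\<close>,
  corrected by left multiplication by \<open>\<phi> x\<close>. The correction reflects that the
  bracket also inserts a cochain into the first argument of the product.\<close>

definition act :: "'g \<Rightarrow> ('g \<Rightarrow> 'g) \<Rightarrow> 'g \<Rightarrow> 'g" where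
  "act x \<phi> w = prd x (\<phi> w) + prd (\<phi> x) w - \<phi> (prd x w)"

lemmas prd_simps = linear_simps[OF prd_linear_left] linear_simps[OF prd_linear_right]

lemma endo_ad: "endo (ad x)"
  unfolding sub_adjacent_def[abs_def] by (intro linear_diff prd_linear_left prd_linear_right)

lemma operator_act: "operator (act x)"
proof -
  have "endo (act x \<phi>)" if "endo \<phi>" for \<phi>
    unfolding act_def[abs_def]
    using that by (intro linear_diff linear_add prd_linear_right linear_comp[OF that prd_linear_right]
        linear_comp[OF prd_linear_right that])
  then show ?thesis
    by (simp add: operator_def fun_eq_iff act_def prd_simps algebra_simps)
qed

lemma act_linear:
  assumes "endo \<phi>"
  shows "act (x + y) \<phi> = act x \<phi> + act y \<phi>" "act (scale c x) \<phi> = (\<lambda>w. scale c (act x \<phi> w))"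
  by (auto simp: fun_eq_iff act_def prd_simps linear_simps[OF assms] algebra_simps)

lemma ad_linear: "ad (x + y) z = ad x z + ad y z" "ad (scale c x) z = scale c (ad x z)"
  by (auto simp: sub_adjacent_def prd_simps algebra_simps)

lemma ad_self [simp]: "ad x x = 0"
  by (simp add: sub_adjacent_def)

lemma ad_ad: "ad a (ad b x) - ad b (ad a x) = ad (ad a b) x"
proof -
  \<comment> \<open>Only instances are used as rewrite rules, because the general identity rewrites
    to its own mirror image.\<close>
  have *: "prd b (prd a x) = prd a (prd b x) + prd (prd b a) x - prd (prd a b) x"
    "prd x (prd a b) = prd a (prd x b) + prd (prd x a) b - prd (prd a x) b"
    "prd x (prd b a) = prd b (prd x a) + prd (prd x b) a - prd (prd b x) a"
    using pre_lie_identity[of a b x] pre_lie_identity[of a x b] pre_lie_identity[of b x a]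
    by (simp_all add: algebra_simps)
  show ?thesis by (simp add: sub_adjacent_def prd_simps * algebra_simps)
qed

text \<open>The representation property behind d d = 0. Linearity of \<open>\<phi>\<close> is what
  expands \<open>\<phi> (ad a b)\<close>.\<close>

lemma act_act:
  assumes "endo \<phi>"
  shows "act a (act b \<phi>) - act b (act a \<phi>) = act (ad a b) \<phi>"
proof
  fix w
  note lin = linear_simps[OF assms]
  have 1: "prd b (prd a w) = prd a (prd b w) + prd (prd b a) w - prd (prd a b) w" for a b w
    using pre_lie_identity[of a b w] by (simp add: algebra_simps)
  show "(act a (act b \<phi>) - act b (act a \<phi>)) w = act (ad a b) \<phi> w"
    by (simp add: act_def sub_adjacent_def prd_simps lin algebra_simps
        1[of "\<phi> b" a w] 1[of "\<phi> a" b w] 1[of b a w] 1[of b a "\<phi> w"])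
qed

lemma derivation_action_act:
  assumes T: "endo T" "\<And>x y. T (prd x y) = prd (T x) y + prd x (T y)" and "endo \<phi>"
  shows "derivation_action T (act y \<phi>) - act y (derivation_action T \<phi>) = act (T y) \<phi>"
  by (rule ext) (simp add: derivation_action_def act_def T prd_simps linear_simps[OF T(1)]
      linear_simps[OF \<open>endo \<phi>\<close>] algebra_simps)

text \<open>
  The Chevalley-Eilenberg differential of the sub-adjacent Lie algebra with values in
  \<open>Hom (W, W)\<close>, defined by recursion through Cartan's formula \<open>\<iota>\<^sub>a d + d \<iota>\<^sub>a = L\<^sub>a\<close>.
\<close>

fun cobd :: "nat \<Rightarrow> ((nat \<Rightarrow> 'g) \<Rightarrow> 'g \<Rightarrow> 'g) \<Rightarrow> (nat \<Rightarrow> 'g) \<Rightarrow> 'g \<Rightarrow> 'g" where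
  "cobd 0 f x = act (x 0) (f (\<lambda>i. x (Suc i)))"
| "cobd (Suc q) f x = lie (Suc q) (ad (x 0)) (act (x 0)) f (\<lambda>i. x (Suc i)) -
     cobd q (ins (x 0) f) (\<lambda>i. x (Suc i))"

lemma ins_cobd_0: "ins a (cobd 0 f) = lie 0 (ad a) (act a) f"
  and ins_cobd_Suc: "ins a (cobd (Suc q) f) = lie (Suc q) (ad a) (act a) f - cobd q (ins a f)"
  by (auto simp: ins_def fun_eq_iff lie_0)

lemma cobd_add: "cobd q (f + g) = cobd q f + cobd q g"
proof (induction q arbitrary: f g)
  case 0
  show ?case by (intro ext) (simp add: act_def prd_simps algebra_simps)
next
  case (Suc q)
  show ?case
    by (rule eq_if_ins_eq) (simp only: ins_cobd_Suc ins_add lie_add[OF operator_act] Suc.IH add_diff_add)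
qed

lemma cobd_scale: "cobd q (\<lambda>x w. scale c (f x w)) = (\<lambda>x w. scale c (cobd q f x w))"
proof (induction q arbitrary: f)
  case 0
  then show ?case by (intro ext) (simp add: operator_simps[OF operator_act])
next
  case (Suc q)
  have "ins a (\<lambda>x w. scale c (h x w)) = (\<lambda>x w. scale c (ins a h x w))"
    for a and h :: "(nat \<Rightarrow> 'g) \<Rightarrow> 'g \<Rightarrow> 'g"
    by (simp add: ins_def fun_eq_iff)
  then have "ins a (cobd (Suc q) (\<lambda>x w. scale c (f x w))) = ins a (\<lambda>x w. scale c (cobd (Suc q) f x w))" for a
    by (simp only: ins_cobd_Suc lie_scale[OF operator_act] Suc.IH, simp add: fun_eq_iff scale_right_diff_distrib)
  then show ?case by (rule eq_if_ins_eq)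
qed

lemma cobd_uminus: "cobd q (- f) = - cobd q f"
  using cobd_scale[of q "-1" f] by (simp add: fun_Compl_def)

lemma cobd_zero: "cobd q 0 = 0"
  using cobd_scale[of q 0 "\<lambda>x. id"] by (simp add: zero_fun_def)

lemma cobd_minus: "cobd q (f - g) = cobd q f - cobd q g"
  using cobd_add[of q f "- g"] by (simp add: cobd_uminus)

text \<open>Serves the linearity of \<open>cobd q f\<close> in its first argument. The cochain
  hypothesis enters because \<open>a\<close> also occurs inside the arguments of
  \<open>f\<close>.\<close>

lemma lie_ad_act_linear:
  assumes "f \<in> cochains q"
  shows "endo (\<lambda>a. lie q (ad a) (act a) f x b)"
proof (intro linearI vector_space_axioms)
  note f = alt_hom_slot_linear[OF assms]
  note act = act_linear[OF alt_hom_last_linear[OF assms]]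
  fix a a' c
  have "(\<Sum>j<q. f (x(j := ad (a + a') (x j))) b) =
      (\<Sum>j<q. f (x(j := ad a (x j))) b) + (\<Sum>j<q. f (x(j := ad a' (x j))) b)"
    unfolding sum.distrib[symmetric] ad_linear by (intro sum.cong refl linear_simps(1)[OF f]) simp
  then show "lie q (ad (a + a')) (act (a + a')) f x b =
      lie q (ad a) (act a) f x b + lie q (ad a') (act a') f x b"
    by (simp add: lie_def act sum_fun_apply)
  have "(\<Sum>j<q. f (x(j := ad (scale c a) (x j))) b) = scale c (\<Sum>j<q. f (x(j := ad a (x j))) b)"
    unfolding scale_sum_right ad_linear by (intro sum.cong refl linear_simps(2)[OF f]) simp
  then show "lie q (ad (scale c a)) (act (scale c a)) f x b = scale c (lie q (ad a) (act a) f x b)"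
    by (simp add: lie_def act sum_fun_apply scale_right_diff_distrib)
qed

text \<open>Alternation is Cartan calculus: contracting L_a f - d (ins a f) once more with
  \<open>a\<close>, the two terms L_a (ins a f) cancel, and the rest contracts with
  \<open>ad a a\<close>, which is 0, or twice with \<open>a\<close>.\<close>

lemma cobd_mem: "f \<in> cochains q \<Longrightarrow> cobd q f \<in> cochains (Suc q)"
proof (induction q arbitrary: f)
  case 0
  show ?case
  proof (rule alt_hom_SucI)
    show "ins a (cobd 0 f) \<in> cochains 0" for a
      unfolding ins_cobd_0 by (intro lie_mem endo_ad operator_act 0)
    show "endo (\<lambda>a. ins a (cobd 0 f) x b)" for x b
      unfolding ins_cobd_0 by (rule lie_ad_act_linear[OF 0])
  qed simp
next
  case (Suc q)
  note f = Suc.prems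
  note lin = linear_simps[OF alt_hom_ins_linear[OF f]]
  show ?case
  proof (rule alt_hom_SucI)
    show "ins a (cobd (Suc q) f) \<in> cochains (Suc q)" for a
      unfolding ins_cobd_Suc
      by (intro alt_hom_diff vector_space_axioms lie_mem endo_ad operator_act f Suc.IH alt_hom_ins)
    show "endo (\<lambda>a. ins a (cobd (Suc q) f) x b)" for x b
    proof -
      have "ins (a + c) f = ins a f + ins c f" for a c by (simp add: fun_eq_iff lin)
      moreover have "ins (scale c a) f = (\<lambda>x w. scale c (ins a f x w))" for a c by (simp add: fun_eq_iff lin)
      ultimately have "endo (\<lambda>a. cobd q (ins a f) x b)"
        by (intro linearI vector_space_axioms) (simp_all add: cobd_add cobd_scale)
      with lie_ad_act_linear[OF f] show ?thesis by (simp add: ins_cobd_Suc linear_diff)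
    qed
    show "ins a (ins a (cobd (Suc q) f)) x b = 0" for a x b
    proof (cases q)
      case 0
      then show ?thesis using lin by (simp add: ins_cobd_Suc ins_cobd_0 ins_lie)
    next
      case (Suc q')
      then have "f \<in> cochains (Suc (Suc q'))" using f by simp
      from alt_hom_ins_ins_same[OF this, of a] lin show ?thesis
        by (simp add: Suc ins_cobd_Suc ins_lie cobd_zero del: cobd.simps)
    qed
  qed
qed

text \<open>The value action \<open>\<tau>\<close> is kept abstract to cover both
  \<open>ad a\<close> with \<open>act a\<close> and a derivation with its commutator action.
  Contracted with \<open>y\<close>, the claim becomes [L_T, L_y] = L_(T y), an instance of
  \<open>lie_lie\<close>.\<close>

lemma cobd_lie:
  assumes T: "endo T" and \<tau>: "operator \<tau>"
    and Tad: "\<And>y z. T (ad y z) = ad (T y) z + ad y (T z)"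
    and \<tau>act: "\<And>y \<phi>. endo \<phi> \<Longrightarrow> \<tau> (act y \<phi>) - act y (\<tau> \<phi>) = act (T y) \<phi>"
    and "f \<in> cochains q"
  shows "lie (Suc q) T \<tau> (cobd q f) = cobd q (lie q T \<tau> f)"
  using assms(5)
proof (induction q arbitrary: f)
  case (0 f)
  have "lie 0 T \<tau> (lie 0 (ad y) (act y) f) - lie 0 (ad y) (act y) (lie 0 T \<tau> f) =
      lie 0 (ad (T y)) (act (T y)) f" for y
    using Tad by (intro lie_lie \<tau> operator_act 0 endo_ad T \<tau>act) (auto simp: algebra_simps)
  note diff_eq_swap[OF this]
  then show ?case
    by (intro eq_if_ins_eq[of "lie _ _ _ _"]) (simp only: ins_lie ins_cobd_0)
next
  case (Suc q)
  note f = Suc.prems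
  have "lie (Suc q) T \<tau> (lie (Suc q) (ad y) (act y) f) - lie (Suc q) (ad y) (act y) (lie (Suc q) T \<tau> f) =
      lie (Suc q) (ad (T y)) (act (T y)) f" for y
    using Tad by (intro lie_lie \<tau> operator_act f endo_ad T \<tau>act) (auto simp: algebra_simps)
  from commutator_shift_eq[OF this] show ?case
    by (intro eq_if_ins_eq[of "lie _ _ _ _"])
      (simp only: ins_lie ins_cobd_Suc lie_diff[OF \<tau>] cobd_minus Suc.IH[OF alt_hom_ins[OF f]])
qed

lemma cobd_lie_ad:
  assumes "f \<in> cochains q"
  shows "lie (Suc q) (ad a) (act a) (cobd q f) = cobd q (lie q (ad a) (act a) f)"
proof (rule cobd_lie[OF endo_ad operator_act _ act_act assms])
  show "ad a (ad y z) = ad (ad a y) z + ad y (ad a z)" for y z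
    using ad_ad[of a y z] by (simp add: algebra_simps)
qed

lemma cobd_lie_derivation:
  assumes T: "endo T" "\<And>x y. T (prd x y) = prd (T x) y + prd x (T y)" and "f \<in> cochains q"
  shows "lie (Suc q) T (derivation_action T) (cobd q f) = cobd q (lie q T (derivation_action T) f)"
proof (rule cobd_lie[OF T(1) operator_derivation_action[OF T(1)] _ derivation_action_act[OF T] assms(3)])
  show "T (ad y z) = ad (T y) z + ad y (T z)" for y z
    by (simp add: sub_adjacent_def T linear_simps[OF T(1)])
qed

text \<open>The contraction of d d f with \<open>a\<close> is L_a d f - d L_a f + d d (ins a f): the
  first two terms cancel by \<open>cobd_lie_ad\<close>, the third vanishes by induction.\<close>

lemma cobd_cobd:
  assumes "f \<in> cochains q" shows "cobd (Suc q) (cobd q f) = 0"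
  using assms
proof (induction q arbitrary: f)
  case (0 f)
  have "ins a (cobd (Suc 0) (cobd 0 f)) = 0" for a
    using cobd_lie_ad[OF 0, of a] by (simp add: ins_cobd_Suc ins_cobd_0 del: cobd.simps)
  then show ?case by (intro ext) (metis ins_head_tail zero_fun_apply)
next
  case (Suc q)
  have "ins a (cobd (Suc (Suc q)) (cobd (Suc q) f)) = 0" for a
    using cobd_lie_ad[OF Suc.prems, of a] Suc.IH[OF alt_hom_ins[OF Suc.prems]]
    by (simp only: ins_cobd_Suc cobd_minus diff_zero diff_self ins_zero)
  then show ?case by (intro ext) (metis ins_head_tail zero_fun_apply)
qed

end

section \<open>The bracket with the product and with an endomorphism\<close>

context pre_lie_algebra
begin

lemma scale_minus_one_power: "scale ((-1) ^ i) (scale ((-1) ^ i) v) = v"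
  by (simp flip: power_mult_distrib)

lemma scale_minus_one_power_add: "scale ((-1) ^ q) (scale ((-1) ^ (i + q)) v) = scale ((-1) ^ i) v"
  unfolding add.commute[of i] power_add scale_scale[symmetric] by (rule scale_minus_one_power)

text \<open>Moving \<open>u\<close> from the front into the gap at \<open>i\<close> crosses
  \<open>i\<close> entries. The resulting sign later cancels that of
  \<open>to_front i\<close>.\<close>

lemma cochain_front:
  assumes f: "f \<in> cochains q" and "i < q"
  shows "f (\<lambda>m. if m = 0 then u else y (to_front i m)) w = scale ((-1) ^ i) (f (y(i := u)) w)"
proof -
  have "(\<lambda>m. if m = 0 then u else y (to_front i m)) = (\<lambda>m. (y(i := u)) (to_front i m))"
    by (auto simp: fun_eq_iff to_front_def)
  moreover obtain q' where "q = Suc q'" using \<open>i < q\<close> by (cases q) auto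
  ultimately show ?thesis
    using alt_hom_permute[OF f, of "to_front i" "y(i := u)" w] permutes_to_front[of i q'] \<open>i < q\<close>
    by (simp add: sign_to_front lessThan_Suc_atMost)
qed

text \<open>
  Left multiplications replace \<open>ad\<close> here, because \<open>f \<circ> \<Delta>\<close> sums over ordered pairs of arguments; for
  alternating \<open>f\<close> the sum is the same.
\<close>

definition alternating_sum :: "nat \<Rightarrow> ((nat \<Rightarrow> 'g) \<Rightarrow> 'g \<Rightarrow> 'g) \<Rightarrow> (nat \<Rightarrow> 'g) \<Rightarrow> 'g \<Rightarrow> 'g" where
  "alternating_sum q f x w = (\<Sum>i\<le>q. scale ((-1) ^ i)
     (lie q (prd (x i)) (act (x i)) f (\<lambda>j. x (skip i j)) w))"

text \<open>After contraction with \<open>a\<close>, the term i = 0 is the Lie derivative for left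
  multiplication by \<open>a\<close>. The other terms give the sum for \<open>ins a f\<close> and,
  through \<open>ins_lie\<close>, contractions with prd (x i) a; the latter turn left multiplication
  by \<open>a\<close> into \<open>ad a\<close>, which is Cartan's formula.\<close>

lemma alternating_sum_eq_cobd:
  assumes "f \<in> cochains q"
  shows "alternating_sum q f = cobd q f"
  using assms
proof (induction q arbitrary: f)
  case (0 f)
  have "ins a (alternating_sum 0 f) = ins a (cobd 0 f)" for a
    unfolding ins_cobd_0 by (intro ext) (simp add: alternating_sum_def ins_def lie_0 skip_def)
  then show ?case by (rule eq_if_ins_eq)
next
  case (Suc q)
  note f = Suc.prems
  have "ins a (alternating_sum (Suc q) f) x w = ins a (cobd (Suc q) f) x w" for a x w
  proof -
    define F where "F i = f (x(i := prd (x i) a)) w" for i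
    have skip0: "skip 0 j = Suc j" for j by (simp add: skip_def)
    have case_skip: "(\<lambda>j. case_nat a x (skip (Suc i) j)) = case_nat a (\<lambda>j. x (skip i j))" for i
      by (auto simp: fun_eq_iff skip_def split: nat.split)
    \<comment> \<open>The alternating sign is used up in moving the product from the front to slot
      \<open>i\<close>.\<close>
    have F: "scale ((-1) ^ i) (f (case_nat (prd (x i) a) (\<lambda>j. x (skip i j))) w) = F i" if "i \<le> q" for i
    proof -
      have "case_nat (prd (x i) a) (\<lambda>j. x (skip i j)) = (\<lambda>m. if m = 0 then prd (x i) a else x (to_front i m))"
        by (auto simp: fun_eq_iff split: nat.split)
      then have "f (case_nat (prd (x i) a) (\<lambda>j. x (skip i j))) w = scale ((-1) ^ i) (F i)"
        unfolding F_def using that by (simp only: cochain_front[OF f])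
      then show ?thesis by (simp only: scale_minus_one_power)
    qed
    have "ins a (alternating_sum (Suc q) f) x w = lie (Suc q) (prd a) (act a) f x w +
        (\<Sum>i\<le>q. scale ((-1) ^ Suc i)
          (ins a (lie (Suc q) (prd (x i)) (act (x i)) f) (\<lambda>j. x (skip i j)) w))"
      unfolding ins_def alternating_sum_def sum.atMost_Suc_shift
      by (simp add: skip0 case_skip del: power_Suc)
    also have "\<dots> = lie (Suc q) (prd a) (act a) f x w - alternating_sum q (ins a f) x w +
        (\<Sum>i\<le>q. scale ((-1) ^ i) (ins (prd (x i) a) f (\<lambda>j. x (skip i j)) w))"
      by (simp add: ins_lie alternating_sum_def scale_right_diff_distrib sum_subtractf sum_negf)
    also have "(\<Sum>i\<le>q. scale ((-1) ^ i) (ins (prd (x i) a) f (\<lambda>j. x (skip i j)) w)) = (\<Sum>i\<le>q. F i)"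
      by (intro sum.cong refl) (simp add: ins_def F)
    also have "lie (Suc q) (prd a) (act a) f x w - alternating_sum q (ins a f) x w + (\<Sum>i\<le>q. F i) =
        lie (Suc q) (ad a) (act a) f x w - cobd q (ins a f) x w"
    proof -
      have "f (x(j := ad a (x j))) w = f (x(j := prd a (x j))) w - F j" if "j < Suc q" for j
        unfolding sub_adjacent_def F_def by (rule linear_simps(4)[OF alt_hom_slot_linear[OF f that]])
      then have "(\<Sum>j<Suc q. f (x(j := ad a (x j))) w) =
          (\<Sum>j<Suc q. f (x(j := prd a (x j))) w) - (\<Sum>j<Suc q. F j)"
        unfolding sum_subtractf[symmetric] by (intro sum.cong) auto
      then show ?thesis
        using Suc.IH[OF alt_hom_ins[OF f]]
        by (simp add: lie_def sum_fun_apply lessThan_Suc_atMost del: sum.lessThan_Suc)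
    qed
    finally show ?thesis by (simp add: ins_cobd_Suc del: cobd.simps)
  qed
  then have "ins a (alternating_sum (Suc q) f) = ins a (cobd (Suc q) f)" for a by (intro ext)
  then show ?case by (rule eq_if_ins_eq)
qed

text \<open>Each index \<open>i\<close> occurs twice, with \<open>f\<close> inserted into the first
  or the second argument of the product. The sign (-1)^(i+q) of \<open>to_place\<close> matches the
  factor (-1)^q standing before the second sum.\<close>

lemma MN_circ_product_left:
  assumes f: "f \<in> cochains q"
  shows "MN_circ scale 1 q (\<lambda>x w. prd (x 0) w) f x w = scale ((-1) ^ q)
    (\<Sum>i\<le>q. scale ((-1) ^ i) (prd (f (\<lambda>j. x (skip i j)) (x i)) w + prd (x i) (f (\<lambda>j. x (skip i j)) w)))"
proof -
  have to_place: "f (\<lambda>j. x (to_place q i j)) (x (to_place q i q)) = f (\<lambda>j. x (skip i j)) (x i)" for i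
    using cochains_cong[OF f, of "\<lambda>j. x (to_place q i j)" "\<lambda>j. x (skip i j)"]
    by (simp add: to_place_def)
  have "(\<Sum>\<sigma>\<in>unshuffles [q, 1, 0]. scale (of_int (sign \<sigma>)) (prd (f (\<lambda>j. x (\<sigma> j)) (x (\<sigma> q))) w)) =
      (\<Sum>i\<le>q. scale ((-1) ^ (i + q)) (prd (f (\<lambda>j. x (skip i j)) (x i)) w))"
    unfolding unshuffles_q_1_0 unshuffles_q_1 sum.reindex[OF unshuffles_q_1(2)]
    by (intro sum.cong) (auto simp: sign_to_place to_place)
  moreover have "(\<Sum>\<sigma>\<in>unshuffles [1, q]. scale (of_int (sign \<sigma>)) (prd (x (\<sigma> 0)) (f (\<lambda>j. x (\<sigma> (Suc j))) w))) =
      (\<Sum>i\<le>q. scale ((-1) ^ i) (prd (x i) (f (\<lambda>j. x (skip i j)) w)))"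
    unfolding unshuffles_1_q sum.reindex[OF unshuffles_1_q(2)]
    by (intro sum.cong) (auto simp: sign_to_front)
  moreover have "scale ((-1) ^ q)
      (\<Sum>i\<le>q. scale ((-1) ^ i) (prd (f (\<lambda>j. x (skip i j)) (x i)) w + prd (x i) (f (\<lambda>j. x (skip i j)) w))) =
      (\<Sum>i\<le>q. scale ((-1) ^ (i + q)) (prd (f (\<lambda>j. x (skip i j)) (x i)) w)) +
      scale ((-1) ^ q) (\<Sum>i\<le>q. scale ((-1) ^ i) (prd (x i) (f (\<lambda>j. x (skip i j)) w)))"
    by (simp add: scale_sum_right scale_right_distrib sum.distrib power_add mult.commute)
  ultimately show ?thesis by (simp add: MN_circ_def)
qed

lemma MN_circ_product_right:
  assumes f: "f \<in> cochains q"
  shows "MN_circ scale q 1 f (\<lambda>x w. prd (x 0) w) x w =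
    (\<Sum>i\<le>q. scale ((-1) ^ i) (f (\<lambda>j. x (skip i j)) (prd (x i) w) +
      (\<Sum>j<q. f ((\<lambda>j. x (skip i j))(j := prd (x i) (x (skip i j)))) w)))"
proof -
  let ?y = "\<lambda>i j. x (skip i j)"
  have "(\<Sum>\<sigma>\<in>unshuffles [q, 1]. scale (of_int (sign \<sigma>)) (f (\<lambda>j. x (\<sigma> j)) (prd (x (\<sigma> q)) w))) =
      (\<Sum>i\<le>q. scale ((-1) ^ (i + q)) (f (?y i) (prd (x i) w)))"
  proof -
    have "f (\<lambda>j. x (to_place q i j)) (prd (x (to_place q i q)) w) = f (?y i) (prd (x i) w)" for i
      using cochains_cong[OF f, of "\<lambda>j. x (to_place q i j)" "?y i"]
      by (simp add: to_place_def)
    then show ?thesis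
      unfolding unshuffles_q_1 sum.reindex[OF unshuffles_q_1(2)]
      by (intro sum.cong) (auto simp: sign_to_place)
  qed
  then have 1: "scale ((-1) ^ q) (\<Sum>\<sigma>\<in>unshuffles [q, 1]. scale (of_int (sign \<sigma>))
      (f (\<lambda>j. x (\<sigma> j)) (prd (x (\<sigma> q)) w))) = (\<Sum>i\<le>q. scale ((-1) ^ i) (f (?y i) (prd (x i) w)))"
    by (simp only: scale_sum_right scale_minus_one_power_add)
  \<comment> \<open>For q = 0 the first sum of \<open>MN_circ\<close> is absent, in agreement with
    the empty sum over j < q.\<close>
  have 2: "(if q = 0 then 0 else \<Sum>\<sigma>\<in>unshuffles [1, 1, q - 1]. scale (of_int (sign \<sigma>))
      (f (\<lambda>i. if i = 0 then prd (x (\<sigma> 0)) (x (\<sigma> 1)) else x (\<sigma> (1 + i))) w)) =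
      (\<Sum>i\<le>q. \<Sum>j<q. scale ((-1) ^ i) (f ((?y i)(j := prd (x i) (?y i j))) w))"
  proof (cases q)
    case (Suc q')
    \<comment> \<open>The sign (-1)^j of the second choice is absorbed by moving the product into
      slot \<open>j\<close>; only (-1)^i remains.\<close>
    have *: "scale (of_int (sign (to_front i \<circ> fix_front (to_front j))))
        (f (\<lambda>m. if m = 0 then prd (x i) (?y i j) else ?y i (to_front j m)) w) =
        scale ((-1) ^ i) (f ((?y i)(j := prd (x i) (?y i j))) w)" if "i \<le> Suc q'" "j \<le> q'" for i j
    proof -
      have "permutation (fix_front (to_front j))"
        using permutes_fix_front_to_front[OF that(2)] by (auto simp: permutation_permutes)
      then have "sign (to_front i \<circ> fix_front (to_front j)) = (-1) ^ i * (-1) ^ j"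
        by (simp only: sign_compose[OF permutation_to_front] sign_to_front sign_fix_front_to_front)
      moreover have "f (\<lambda>m. if m = 0 then prd (x i) (?y i j) else ?y i (to_front j m)) w =
          scale ((-1) ^ j) (f ((?y i)(j := prd (x i) (?y i j))) w)"
        using that Suc by (intro cochain_front[OF f, of j _ "?y i"]) simp
      ultimately show ?thesis
        by (simp add: scale_minus_one_power flip: scale_scale)
    qed
    show ?thesis
      unfolding Suc unshuffles_1_1_q diff_Suc_1 sum.reindex[OF unshuffles_1_1_q(2)]
        sum.cartesian_product lessThan_Suc_atMost if_not_P[OF nat.distinct(2)]
      by (intro sum.cong)
        (auto simp only: o_apply case_prod_conv One_nat_def plus_nat.simps to_front_0 to_front_Suc
          fix_front_0 fix_front_Suc atMost_iff mem_Sigma_iff nat.distinct if_False *)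
  qed simp
  show ?thesis
    unfolding MN_circ_def mult_1_right add_0_right 1 2
    by (simp add: scale_right_distrib sum.distrib scale_sum_right)
qed

text \<open>Both compositions carry the factor (-1)^q, one by \<open>MN_circ_product_left\<close>,
  the other by the definition of the bracket. What is left regroups into \<open>act\<close> and the
  replaced arguments.\<close>

lemma MN_bracket_product:
  assumes f: "f \<in> cochains q"
  shows "MN_bracket scale 1 q (\<lambda>x w. prd (x 0) w) f = (\<lambda>x w. scale ((-1) ^ q) (cobd q f x w))"
proof (intro ext)
  fix x w
  have "cobd q f x w = (\<Sum>i\<le>q. scale ((-1) ^ i)
      (prd (f (\<lambda>j. x (skip i j)) (x i)) w + prd (x i) (f (\<lambda>j. x (skip i j)) w))) -
    (\<Sum>i\<le>q. scale ((-1) ^ i) (f (\<lambda>j. x (skip i j)) (prd (x i) w) +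
      (\<Sum>j<q. f ((\<lambda>j. x (skip i j))(j := prd (x i) (x (skip i j)))) w)))"
    unfolding alternating_sum_eq_cobd[OF f, symmetric] alternating_sum_def sum_subtractf[symmetric]
      scale_right_diff_distrib[symmetric]
    by (intro sum.cong refl arg_cong[where f = "scale _"])
      (simp add: lie_def act_def sum_fun_apply algebra_simps)
  then show "MN_bracket scale 1 q (\<lambda>x w. prd (x 0) w) f x w = scale ((-1) ^ q) (cobd q f x w)"
    unfolding MN_bracket_def MN_circ_product_left[OF f] MN_circ_product_right[OF f]
    by (simp add: scale_right_diff_distrib)
qed

lemma MN_bracket_endo:
  assumes f: "f \<in> cochains q"
  shows "MN_bracket scale q 0 f (\<lambda>_. T) = - lie q T (derivation_action T) f"
proof (intro ext)
  fix x w
  have *: "(if q = 0 then 0 else \<Sum>\<sigma>\<in>unshuffles [0, 1, q - 1]. scale (of_int (sign \<sigma>))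
      (f (\<lambda>i. if i = 0 then T (x (\<sigma> 0)) else x (\<sigma> i)) w)) =
      (\<Sum>j<q. f (x(j := T (x j))) w)"
  proof (cases q)
    case (Suc q')
    \<comment> \<open>Moving T (x j) from the front to slot \<open>j\<close> cancels the sign of the
      unshuffle.\<close>
    have "scale (of_int (sign (to_front j)))
        (f (\<lambda>i. if i = 0 then T (x j) else x (to_front j i)) w) = f (x(j := T (x j))) w" if "j \<le> q'" for j
      using cochain_front[OF f, of j] that Suc by (simp add: sign_to_front scale_minus_one_power)
    then show ?thesis
      unfolding Suc unshuffles_0_1_q diff_Suc_1 unshuffles_1_q sum.reindex[OF unshuffles_1_q(2)]
        lessThan_Suc_atMost comp_def to_front_0 if_not_P[OF nat.distinct(2)]
      by (intro sum.cong refl) simp_all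
  qed simp
  show "MN_bracket scale q 0 f (\<lambda>_. T) x w = (- lie q T (derivation_action T) f) x w"
    unfolding MN_bracket_def MN_circ_def add_0 *
    by (simp add: unshuffles_0 lie_def derivation_action_def sum_fun_apply)
qed

end

section \<open>Weights\<close>

lemma alt_hom_zero_slot:
  assumes "P \<in> alt_hom k sa sb sc" "i < k" "x i = 0"
  shows "P x b = 0"
  using linear_simps(3)[OF alt_hom_slot_linear[OF assms(1,2), of x b]] assms(3)
  by (metis fun_upd_triv)

text \<open>Slot \<open>k\<close> will hold the argument from \<open>V\<close> when the
  \<mu>-component of a cochain is extracted.\<close>

lemma alt_hom_fix_last:
  assumes P: "P \<in> alt_hom (Suc k) sa sb sc"
  shows "(\<lambda>x b. P (x(k := e)) b) \<in> alt_hom k sa sb sc"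
proof -
  have "P (x(k := e)) b = P (y(k := e)) b" if "\<forall>i<k. x i = y i" for x y b
    using that by (intro alt_hom_cong[OF P]) auto
  moreover have "Vector_Spaces.linear sa sc (\<lambda>a. P (x(i := a, k := e)) b)" if "i < k" for i x b
    using alt_hom_slot_linear[OF P, of i "x(k := e)" b] that by (simp add: fun_upd_twist)
  moreover have "P (x(k := e)) b = 0" if "i < k" "j < k" "i \<noteq> j" "x i = x j" for i j x b
    using that by (intro alt_hom_alternating[OF P, of i j]) auto
  ultimately show ?thesis
    using alt_hom_last_linear[OF P] unfolding alt_hom_def by blast
qed

text \<open>The \<mu>-lift without its projections. It antisymmetrises over the choice of the
  distinguished argument, (-1)^(k-i) being the sign of \<open>to_place k i\<close>.\<close>

definition insert_alternating ::
  "('k::field \<Rightarrow> 'c::ab_group_add \<Rightarrow> 'c) \<Rightarrow> nat \<Rightarrow> ((nat \<Rightarrow> 'a) \<Rightarrow> 'a \<Rightarrow> 'b \<Rightarrow> 'c) \<Rightarrow>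
    (nat \<Rightarrow> 'a) \<Rightarrow> 'b \<Rightarrow> 'c" where
  "insert_alternating sc k f x w = (\<Sum>i\<le>k. sc ((-1) ^ (k - i)) (f (\<lambda>j. x (skip i j)) (x i) w))"

lemma ins_insert_alternating:
  "ins a (insert_alternating sc (Suc k) f) x w =
    sc ((-1) ^ Suc k) (f x a w) + insert_alternating sc k (ins a f) x w"
proof -
  have "(\<lambda>j. case_nat a x (skip 0 j)) = x"
    "(\<lambda>j. case_nat a x (skip (Suc i) j)) = case_nat a (\<lambda>j. x (skip i j))" for i
    by (auto simp: fun_eq_iff skip_def split: nat.split)
  then show ?thesis
    unfolding ins_def insert_alternating_def sum.atMost_Suc_shift by simp
qed

lemma alt_hom2_slot:
  assumes "f \<in> alt_hom2 k sa se sb sc"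
  shows "(\<lambda>x b. f x e b) \<in> alt_hom k sa sb sc" "Vector_Spaces.linear se sc (\<lambda>e. f x e b)"
  using assms by (auto simp: alt_hom2_def)

lemma alt_hom2_ins:
  assumes "f \<in> alt_hom2 (Suc k) sa se sb sc"
  shows "ins a f \<in> alt_hom2 k sa se sb sc"
  using alt_hom_ins[OF alt_hom2_slot(1)[OF assms], of a] alt_hom2_slot(2)[OF assms]
  by (simp add: alt_hom2_def ins_def[abs_def])

text \<open>Alternation rests on a cancellation: after two contractions with \<open>a\<close>, two
  terms have \<open>a\<close> as the distinguished argument, with opposite signs, and the remaining
  terms contract \<open>f\<close> itself twice.\<close>

lemma insert_alternating_mem:
  assumes "vector_space sa" "f \<in> alt_hom2 k sa sa sb sc"
  shows "insert_alternating sc k f \<in> alt_hom (Suc k) sa sb sc"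
  using assms(2)
proof (induction k arbitrary: f)
  case 0
  note f = alt_hom2_slot[OF 0]
  interpret sc: vector_space sc using f(2) by (simp add: Vector_Spaces.linear_iff)
  have eq: "ins a (insert_alternating sc 0 f) = (\<lambda>x w. f x a w)" for a
  proof (intro ext)
    fix x w
    have "f (\<lambda>j. case_nat a x (skip 0 j)) a w = f x a w"
      by (rule alt_hom_cong[OF f(1)]) simp
    then show "ins a (insert_alternating sc 0 f) x w = f x a w"
      by (simp add: ins_def insert_alternating_def)
  qed
  show ?case by (rule alt_hom_SucI) (simp_all add: eq f)
next
  case (Suc k)
  note f = alt_hom2_slot[OF Suc.prems]
  interpret sc: vector_space sc using f(2) by (simp add: Vector_Spaces.linear_iff)
  have eq: "ins a (insert_alternating sc (Suc k) f) =
      (\<lambda>x w. sc ((-1) ^ Suc k) (f x a w)) + insert_alternating sc k (ins a f)" for a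
    by (intro ext) (simp only: ins_insert_alternating plus_fun_apply)
  show ?case
  proof (rule alt_hom_SucI)
    show "ins a (insert_alternating sc (Suc k) f) \<in> alt_hom (Suc k) sa sb sc" for a
      unfolding eq by (intro alt_hom_add alt_hom_scale assms(1) f Suc.IH alt_hom2_ins Suc.prems)
    show "Vector_Spaces.linear sa sc (\<lambda>a. ins a (insert_alternating sc (Suc k) f) x b)" for x b
    proof -
      have "Vector_Spaces.linear sa sc (\<lambda>a. ins a f y c b)" for y c
        using alt_hom_ins_linear[OF f(1)[of c], of y b] by (simp add: ins_def)
      then have "Vector_Spaces.linear sa sc (\<lambda>a. insert_alternating sc k (ins a f) x b)"
        unfolding insert_alternating_def
        using linear_simps[of sa sc "\<lambda>a. ins a f _ _ b"]
        by (intro linearI assms(1) sc.vector_space_axioms)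
          (simp_all add: sc.scale_right_distrib sum.distrib sc.scale_sum_right mult.commute)
      then show ?thesis
        unfolding ins_insert_alternating by (intro linear_add linear_scale f)
    qed
    show "ins a (ins a (insert_alternating sc (Suc k) f)) x b = 0" for a x b
    proof (cases k)
      case 0
      have "insert_alternating sc 0 (ins a f) (case_nat a x) b = f (case_nat a x) a b"
        using alt_hom_cong[OF f(1)[of a], of "case_nat a (\<lambda>j. case_nat a x (skip 0 j))" "case_nat a x" b] 0
        by (simp add: insert_alternating_def ins_def)
      then show ?thesis
        unfolding ins_def[of a "ins a _"] ins_insert_alternating 0 by simp
    next
      case (Suc k')
      have "ins a (ins a f) y c b = 0" for y c
        using alt_hom_ins_ins_same[of "\<lambda>x b. f x c b" k' sa sb sc a] f(1)[of c] Suc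
        by (simp add: ins_def fun_eq_iff)
      then have "insert_alternating sc k' (ins a (ins a f)) x b = 0"
        by (simp add: insert_alternating_def)
      moreover have "insert_alternating sc k (ins a f) (case_nat a x) b =
          sc ((-1) ^ k) (ins a f x a b) + insert_alternating sc k' (ins a (ins a f)) x b"
        using ins_insert_alternating[of a sc k' "ins a f" x b] Suc by (simp add: ins_def)
      ultimately show ?thesis
        unfolding ins_def[of a "ins a _"] ins_insert_alternating by (simp add: ins_def)
    qed
  qed
qed

lemma insert_alternating_eq_lift_mu:
  "lift_mu sv (Suc (Suc k)) f x w =
    (0, insert_alternating sv k (\<lambda>x e b. f (\<lambda>j. fst (x j)) (snd e) (fst b)) x w)"
proof -
  have "(\<lambda>j. if j < i then fst (x j) else fst (x (Suc j))) = (\<lambda>j. fst (x (skip i j)))" for i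
    by (auto simp: skip_def)
  then show ?thesis by (simp add: lift_mu_def insert_alternating_def lessThan_Suc_atMost)
qed

section \<open>Eigenvectors of a Lie derivative\<close>

context pre_lie_algebra
begin

lemma derivation_action_commutator:
  assumes "endo \<phi>" "endo T" "endo S"
  shows "derivation_action T (derivation_action S \<phi>) - derivation_action S (derivation_action T \<phi>) =
    derivation_action (\<lambda>a. T (S a) - S (T a)) \<phi>"
  by (rule ext) (simp add: derivation_action_def assms(1-3)[THEN linear_simps(4)])

definition weight :: "('g \<Rightarrow> 'g) \<Rightarrow> nat \<Rightarrow> 'k \<Rightarrow> ((nat \<Rightarrow> 'g) \<Rightarrow> 'g \<Rightarrow> 'g) \<Rightarrow> bool" where
  "weight E q c F \<longleftrightarrow> lie q E (derivation_action E) F = (\<lambda>x w. scale c (F x w))"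

lemma weight_cobd:
  assumes "endo E" "\<And>x y. E (prd x y) = prd (E x) y + prd x (E y)" "F \<in> cochains q" "weight E q c F"
  shows "weight E (Suc q) c (cobd q F)"
  using cobd_lie_derivation[OF assms(1-3)] assms(4) by (simp add: weight_def cobd_scale)

lemma weight_add:
  assumes "endo E" "weight E q c F" "weight E q c G"
  shows "weight E q c (F + G)"
  using assms(2,3) unfolding weight_def lie_add[OF operator_derivation_action[OF assms(1)]]
  by (simp add: fun_eq_iff scale_right_distrib)

lemma weight_scale:
  assumes "endo E" "weight E q c F"
  shows "weight E q c (\<lambda>x w. scale r (F x w))"
  using assms(2) unfolding weight_def lie_scale[OF operator_derivation_action[OF assms(1)]]
  by (simp add: fun_eq_iff mult.commute)

lemma weight_zero:
  assumes "endo E" shows "weight E q c 0"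
  unfolding weight_def lie_zero[OF operator_derivation_action[OF assms]] by (simp add: fun_eq_iff)

text \<open>By \<open>ins_lie\<close> the eigenvalue of \<open>a\<close> shifts the weight. This
  drives the later inductions on the number of arguments.\<close>

lemma weight_ins:
  assumes "weight E (Suc q) c F" "F \<in> cochains (Suc q)" "E a = scale b a"
  shows "weight E q (c + b) (ins a F)"
proof -
  have "ins (E a) F x w = scale b (ins a F x w)" for x w
    using linear_simps(2)[OF alt_hom_ins_linear[OF assms(2)]] assms(3) by simp
  moreover have "lie q E (derivation_action E) (ins a F) x w - ins (E a) F x w = scale c (ins a F x w)" for x w
    using arg_cong[where f = "\<lambda>G. ins a G x w", OF assms(1)[unfolded weight_def]]
    unfolding ins_lie by (simp add: ins_def)
  ultimately have "lie q E (derivation_action E) (ins a F) x w = scale (c + b) (ins a F x w)" for x w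
    by (metis diff_eq_eq scale_left_distrib)
  then show ?thesis unfolding weight_def by (intro ext)
qed

text \<open>[E, T] = T gives [L_E, L_T] = L_T by \<open>lie_lie\<close>, so L_T raises the weight by
  one.\<close>

lemma weight_lie:
  assumes "endo E" "endo T" "F \<in> cochains q" "weight E q 0 F" "\<And>a. E (T a) - T (E a) = T a"
  shows "weight E q 1 (lie q T (derivation_action T) F)"
proof -
  note op = operator_derivation_action[OF assms(1)] operator_derivation_action[OF assms(2)]
  have "lie q E (derivation_action E) (lie q T (derivation_action T) F) -
      lie q T (derivation_action T) (lie q E (derivation_action E) F) = lie q T (derivation_action T) F"
    using derivation_action_commutator[OF _ assms(1,2)] assms(5)
    by (intro lie_lie op assms(1-3)) auto
  moreover have "lie q E (derivation_action E) F = 0"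
    using assms(4) by (simp add: weight_def fun_eq_iff)
  ultimately show ?thesis
    by (simp add: weight_def lie_zero[OF op(2)])
qed

end

section \<open>The semidirect product\<close>

locale pre_LieDer_pair_char_0 = pre_LieDer_pair sg prd sv \<rho> \<mu> D
  for sg :: "'k::field_char_0 \<Rightarrow> 'g::ab_group_add \<Rightarrow> 'g"
    and prd :: "'g \<Rightarrow> 'g \<Rightarrow> 'g"
    and sv :: "'k \<Rightarrow> 'v::ab_group_add \<Rightarrow> 'v"
    and \<rho> \<mu> :: "'g \<Rightarrow> 'v \<Rightarrow> 'v"
    and D :: "'g \<Rightarrow> 'v"
begin

abbreviation sW :: "'k \<Rightarrow> 'g \<times> 'v \<Rightarrow> 'g \<times> 'v" where
  "sW \<equiv> module_prod.scale sg sv"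

definition semidirect :: "'g \<times> 'v \<Rightarrow> 'g \<times> 'v \<Rightarrow> 'g \<times> 'v" where
  "semidirect x y = (prd (fst x) (fst y), \<rho> (fst x) (snd y) + \<mu> (fst y) (snd x))"

lemma vector_space_sg: "vector_space sg" and vector_space_sv: "vector_space sv"
  by unfold_locales

lemma vector_space_prod: "vector_space_prod sg sv"
  by unfold_locales

lemma sW_eq: "sW c x = (sg c (fst x), sv c (snd x))"
proof -
  interpret P: vector_space_prod sg sv by (rule vector_space_prod)
  show ?thesis by (rule P.scale_def)
qed

lemma vector_space_sW: "vector_space sW"
proof -
  interpret P: vector_space_prod sg sv by (rule vector_space_prod)
  show ?thesis by (rule P.p.vector_space_axioms)
qed

lemma linear_fst: "Vector_Spaces.linear sW sg fst"
  and linear_snd: "Vector_Spaces.linear sW sv snd"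
  by (rule linearI; simp add: vector_space_sW vector_space_sg vector_space_sv sW_eq)+

lemma linear_Pair:
  assumes "Vector_Spaces.linear s sg f" "Vector_Spaces.linear s sv g"
  shows "Vector_Spaces.linear s sW (\<lambda>x. (f x, g x))"
  using assms by (simp add: Vector_Spaces.linear_iff vector_space_sW sW_eq)

lemmas rho_simps = linear_simps[OF rho_linear] linear_simps[OF rho_linear_arg]
  and mu_simps = linear_simps[OF mu_linear] linear_simps[OF mu_linear_arg]
  and D_simps = linear_simps[OF D_linear]

text \<open>In the \<open>V\<close>-component of the pre-Lie identity, the terms in
  \<open>snd z\<close> balance by \<open>rho_bracket\<close>, those in \<open>snd x\<close> and
  \<open>snd y\<close> by \<open>mu_rho\<close>.\<close>

sublocale W: pre_lie_algebra sW semidirect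
proof -
  show "pre_lie_algebra sW semidirect"
  proof (intro pre_lie_algebra.intro vector_space_sW pre_lie_algebra_axioms.intro)
    show "Vector_Spaces.linear sW sW (\<lambda>x. semidirect x y)" for y
      by (rule linearI) (simp_all add: vector_space_sW semidirect_def sW_eq prd_simps rho_simps mu_simps
          V.scale_right_distrib)
    show "Vector_Spaces.linear sW sW (semidirect x)" for x
      by (rule linearI) (simp_all add: vector_space_sW semidirect_def sW_eq prd_simps rho_simps mu_simps
          V.scale_right_distrib)
    fix x y z
    have 1: "\<rho> a (\<rho> b v) = \<rho> b (\<rho> a v) + \<rho> (prd a b) v - \<rho> (prd b a) v" for a b v
      using rho_bracket[of a b v] by (simp add: sub_adjacent_def rho_simps algebra_simps)
    have 2: "\<mu> c (\<mu> b u) = \<mu> (prd b c) u + \<mu> c (\<rho> b u) - \<rho> b (\<mu> c u)" for b c u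
      using mu_rho[of c b u] by (simp add: algebra_simps)
    show "semidirect (semidirect x y) z - semidirect x (semidirect y z) =
        semidirect (semidirect y x) z - semidirect y (semidirect x z)"
      using pre_lie_identity[of "fst x" "fst y" "fst z"]
      by (simp add: semidirect_def rho_simps mu_simps 2 1[of "fst x" "fst y"])
  qed
qed

definition E :: "'g \<times> 'v \<Rightarrow> 'g \<times> 'v" where
  "E x = (0, snd x)"

definition D' :: "'g \<times> 'v \<Rightarrow> 'g \<times> 'v" where
  "D' x = (0, D (fst x))"

lemma endo_E: "W.endo E"
  unfolding E_def[abs_def] by (intro linear_Pair linear_0 linear_snd vector_space_sW vector_space_sg)

lemma endo_D': "W.endo D'"
  unfolding D'_def[abs_def]
  by (intro linear_Pair linear_0 linear_comp[OF linear_fst D_linear] vector_space_sW vector_space_sg)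

text \<open>The product is graded, with \<gg> in degree 0 and \<open>V\<close> in degree 1, because
  two elements of \<open>V\<close> multiply to 0.\<close>

lemma derivation_E: "E (semidirect x y) = semidirect (E x) y + semidirect x (E y)"
  by (simp add: E_def semidirect_def prd_simps rho_simps mu_simps)

lemma derivation_D': "D' (semidirect x y) = semidirect (D' x) y + semidirect x (D' y)"
  by (simp add: D'_def semidirect_def prd_simps rho_simps mu_simps D_derivation)

lemma commutator_E_D': "E (D' a) - D' (E a) = D' a"
  by (simp add: E_def D'_def D_simps)

abbreviation \<iota> :: "'g \<Rightarrow> 'g \<times> 'v" where "\<iota> a \<equiv> (a, 0)"
abbreviation \<kappa> :: "'v \<Rightarrow> 'g \<times> 'v" where "\<kappa> v \<equiv> (0, v)"

lemma linear_\<iota>: "Vector_Spaces.linear sg sW \<iota>"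
  by (intro linear_Pair linear_identity linear_0 vector_space_sg vector_space_sv)

lemma linear_\<kappa>: "Vector_Spaces.linear sv sW \<kappa>"
  by (intro linear_Pair linear_identity linear_0 vector_space_sg vector_space_sv)

lemma weight_iff: "W.weight E q c F \<longleftrightarrow>
    (\<forall>x w. E (F x w) - F x (E w) - (\<Sum>j<q. F (x(j := E (x j))) w) = sW c (F x w))"
  by (simp add: W.weight_def lie_def W.derivation_action_def fun_eq_iff sum_fun_apply)

section \<open>Weights of the horizontal lifts\<close>

lemma lift_g_mem:
  assumes f: "f \<in> alt_hom q sg sg sg"
  shows "lift_g f \<in> W.cochains q" "W.weight E q 0 (lift_g f)"
proof -
  show "lift_g f \<in> W.cochains q"
    unfolding lift_g_def using alt_hom_comp[OF f linear_fst linear_fst linear_\<iota>] .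
  show "W.weight E q 0 (lift_g f)"
    unfolding weight_iff
    using alt_hom_zero_slot[OF f] alt_hom_zero[OF f]
    by (simp add: lift_g_def E_def sW_eq zero_prod_def[symmetric])
qed

lemma lift_gV_mem:
  assumes f: "f \<in> alt_hom q sg sg sv"
  shows "lift_gV f \<in> W.cochains q" "W.weight E q 1 (lift_gV f)"
proof -
  show "lift_gV f \<in> W.cochains q"
    unfolding lift_gV_def using alt_hom_comp[OF f linear_fst linear_fst linear_\<kappa>] .
  show "W.weight E q 1 (lift_gV f)"
    unfolding weight_iff
    using alt_hom_zero_slot[OF f] alt_hom_zero[OF f]
    by (simp add: lift_gV_def E_def sW_eq zero_prod_def[symmetric])
qed

lemma lift_rho_mem:
  assumes f: "f \<in> alt_hom q sg sv sv"
  shows "lift_rho f \<in> W.cochains q" "W.weight E q 0 (lift_rho f)"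
proof -
  show "lift_rho f \<in> W.cochains q"
    unfolding lift_rho_def using alt_hom_comp[OF f linear_fst linear_snd linear_\<kappa>] .
  show "W.weight E q 0 (lift_rho f)"
    unfolding weight_iff
    using alt_hom_zero_slot[OF f] alt_hom_zero[OF f]
    by (simp add: lift_rho_def E_def sW_eq zero_prod_def[symmetric])
qed

lemma lift_mu_mem:
  assumes f: "f \<in> alt_hom2 k sg sv sg sv"
  shows "lift_mu sv (Suc (Suc k)) f \<in> W.cochains (Suc k)"
    "W.weight E (Suc k) 0 (lift_mu sv (Suc (Suc k)) f)"
proof -
  note f' = alt_hom2_slot[OF f]
  define h where "h = (\<lambda>(x :: nat \<Rightarrow> 'g \<times> 'v) (e :: 'g \<times> 'v) (b :: 'g \<times> 'v). f (\<lambda>j. fst (x j)) (snd e) (fst b))"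
  have h: "h \<in> alt_hom2 k sW sW sW sv"
    unfolding alt_hom2_def h_def
    using alt_hom_comp[OF f'(1) linear_fst linear_fst linear_identity[OF vector_space_sv]]
      linear_comp[OF linear_snd f'(2)] by simp
  have eq: "lift_mu sv (Suc (Suc k)) f = (\<lambda>x w. \<kappa> (insert_alternating sv k h x w))"
    by (intro ext) (simp add: insert_alternating_eq_lift_mu h_def)
  show "lift_mu sv (Suc (Suc k)) f \<in> W.cochains (Suc k)"
    unfolding eq
    using alt_hom_comp[OF insert_alternating_mem[OF vector_space_sW h]
        linear_identity[OF vector_space_sW] linear_identity[OF vector_space_sW] linear_\<kappa>] .
  \<comment> \<open>Over all slots, the replacement by \<open>E\<close> reproduces the lift exactly
    once. This cancels the term in which \<open>E\<close> acts on the value and leaves weight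
    0.\<close>
  have "(\<Sum>j\<le>k. insert_alternating sv k h (x(j := E (x j))) w) = insert_alternating sv k h x w" for x w
  proof -
    \<comment> \<open>\<open>E\<close> fixes the \<open>V\<close>-part that the distinguished
      argument contributes; in any other slot it feeds 0 into an alternating argument of
      \<open>f\<close>.\<close>
    have "h (\<lambda>l. (x(j := E (x j))) (skip i l)) ((x(j := E (x j))) i) w =
        (if j = i then h (\<lambda>l. x (skip i l)) (x i) w else 0)" if ij: "i \<le> k" "j \<le> k" for i j
    proof (cases "j = i")
      case True
      then show ?thesis by (simp add: h_def E_def skip_neq)
    next
      case False
      then obtain l where "l < k" "skip i l = j" using skip_surj[OF ij] by blast
      then have "f (\<lambda>l. fst ((x(j := E (x j))) (skip i l))) (snd (x i)) (fst w) = 0"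
        by (intro alt_hom_zero_slot[OF f'(1), of l]) (auto simp: E_def)
      then show ?thesis using False by (simp add: h_def)
    qed
    then have "(\<Sum>j\<le>k. insert_alternating sv k h (x(j := E (x j))) w) =
        (\<Sum>j\<le>k. \<Sum>i\<le>k. if j = i then sv ((-1) ^ (k - i)) (h (\<lambda>l. x (skip i l)) (x i) w) else 0)"
      unfolding insert_alternating_def by (intro sum.cong refl) auto
    then show ?thesis by (simp add: insert_alternating_def)
  qed
  moreover have "insert_alternating sv k h x (E w) = 0" for x w
    using alt_hom_zero[OF f'(1)] by (simp add: insert_alternating_def h_def E_def)
  ultimately show "W.weight E (Suc k) 0 (lift_mu sv (Suc (Suc k)) f)"
    unfolding weight_iff eq lessThan_Suc_atMost
    by (simp add: sW_eq E_def zero_prod_def[symmetric] linear_sum_arg[OF linear_\<kappa>, symmetric])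
qed

section \<open>Recovering a cochain from its weight\<close>

lemma E_\<iota>: "E (\<iota> a) = sW 0 (\<iota> a)" and E_\<kappa>: "E (\<kappa> v) = sW 1 (\<kappa> v)"
  by (simp_all add: E_def sW_eq)

lemma cochain_split:
  assumes "F \<in> W.cochains (Suc q)"
  shows "F x w = ins (\<iota> (fst (x 0))) F (\<lambda>i. x (Suc i)) w + ins (\<kappa> (snd (x 0))) F (\<lambda>i. x (Suc i)) w"
proof -
  have "\<iota> (fst (x 0)) + \<kappa> (snd (x 0)) = x 0" by simp
  then show ?thesis
    using linear_simps(1)[OF alt_hom_ins_linear[OF assms]] ins_head_tail[of F x] by metis
qed

lemma cochain_split_last:
  assumes "F \<in> W.cochains q"
  shows "F x w = F x (\<iota> (fst w)) + F x (\<kappa> (snd w))"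
proof -
  have "\<iota> (fst w) + \<kappa> (snd w) = w" by simp
  then show ?thesis
    using linear_simps(1)[OF alt_hom_last_linear[OF assms]] by metis
qed

text \<open>A 0-cochain is an endomorphism of W and L_E is the commutator with \<open>E\<close>: its
  eigenvalue is 0 on the two diagonal blocks, 1 on \<gg> -> V and -1 on V -> \<gg>. Blocks whose
  eigenvalue differs from \<open>c\<close> vanish.\<close>

lemma weight_0_values:
  assumes F: "F \<in> W.cochains 0" and w: "W.weight E 0 (of_nat c) F"
  shows "snd (F x (\<iota> a)) = 0 \<or> c = 1" "fst (F x (\<iota> a)) = 0 \<or> c = 0"
    "snd (F x (\<kappa> v)) = 0 \<or> c = 0" "fst (F x (\<kappa> v)) = 0"
proof -
  have eq: "E (F x w) - F x (E w) = sW (of_nat c) (F x w)" for w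
    using w unfolding weight_iff lessThan_0 sum.empty diff_0_right by blast
  have z: "F x 0 = 0" by (rule linear_simps(3)[OF alt_hom_last_linear[OF F]])
  have \<iota>: "0 = sg (of_nat c) (fst (F x (\<iota> a)))" "snd (F x (\<iota> a)) = sv (of_nat c) (snd (F x (\<iota> a)))"
    using eq[of "\<iota> a"] z by (simp_all add: E_def sW_eq zero_prod_def[symmetric] prod_eq_iff)
  have \<kappa>: "- fst (F x (\<kappa> v)) = sg (of_nat c) (fst (F x (\<kappa> v)))" "0 = sv (of_nat c) (snd (F x (\<kappa> v)))"
    using eq[of "\<kappa> v"] by (simp_all add: E_def sW_eq prod_eq_iff)
  show "fst (F x (\<iota> a)) = 0 \<or> c = 0" using \<iota>(1) by auto
  show "snd (F x (\<kappa> v)) = 0 \<or> c = 0" using \<kappa>(2) by auto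
  have "sv (of_nat c - 1) (snd (F x (\<iota> a))) = 0" using \<iota>(2) by (simp add: V.scale_left_diff_distrib)
  then show "snd (F x (\<iota> a)) = 0 \<or> c = 1"
    by (auto simp: V.scale_eq_0_iff)
  \<comment> \<open>The eigenvalue -1 cannot be a natural number: c + 1 is nonzero in characteristic
    0.\<close>
  have "sg (of_nat (Suc c)) (fst (F x (\<kappa> v))) = 0"
    by (simp add: scale_left_distrib \<kappa>(1)[symmetric])
  then show "fst (F x (\<kappa> v)) = 0" by (simp del: of_nat_Suc)
qed

text \<open>No block has weight above 1. Contraction with an element of \<open>V\<close> raises the
  weight, so \<open>c\<close> varies in the induction.\<close>

lemma weight_ge_2:
  assumes "F \<in> W.cochains q" "W.weight E q (of_nat c) F" "c \<ge> 2"
  shows "F x w = 0"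
  using assms
proof (induction q arbitrary: F x c)
  case 0
  then show ?case
    using weight_0_values[OF 0(1,2)] cochain_split_last[OF 0(1), of x w] by (simp add: prod_eq_iff)
next
  case (Suc q)
  note F = Suc.prems(1)
  have "W.weight E q (of_nat c) (ins (\<iota> a) F)" for a
    using W.weight_ins[OF Suc.prems(2) F E_\<iota>] by simp
  then have "ins (\<iota> a) F y w = 0" for a y
    by (rule Suc.IH[OF alt_hom_ins[OF F] _ \<open>c \<ge> 2\<close>])
  moreover have "W.weight E q (of_nat (Suc c)) (ins (\<kappa> v) F)" for v
    using W.weight_ins[OF Suc.prems(2) F E_\<kappa>] by (simp add: add.commute)
  then have "ins (\<kappa> v) F y w = 0" for v y
    by (rule Suc.IH[OF alt_hom_ins[OF F]]) (use \<open>c \<ge> 2\<close> in simp)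
  ultimately show ?case unfolding cochain_split[OF F, of x w] by simp
qed

lemma case_nat_\<iota>: "case_nat (\<iota> (x 0 :: 'g)) (\<lambda>i. \<iota> (x (Suc i))) = (\<lambda>i. \<iota> (x i))"
  by (auto simp: fun_eq_iff split: nat.split)

text \<open>Inserting an element of \<open>V\<close> would produce weight 2, which forces 0; only
  the \<gg>-parts of the arguments contribute.\<close>

lemma weight_1_eq:
  assumes "F \<in> W.cochains q" "W.weight E q 1 F"
  shows "F x w = \<kappa> (snd (F (\<lambda>i. \<iota> (fst (x i))) (\<iota> (fst w))))"
  using assms
proof (induction q arbitrary: F x)
  case 0
  have "F x = F (\<lambda>i. \<iota> (fst (x i)))" by (rule W.cochains_cong[OF 0(1)]) simp
  then show ?case
    using weight_0_values[OF 0(1), of 1] 0(2) cochain_split_last[OF 0(1), of x w] by (simp add: prod_eq_iff)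
next
  case (Suc q)
  note F = Suc.prems(1)
  have "W.weight E q 1 (ins (\<iota> a) F)" for a
    using W.weight_ins[OF Suc.prems(2) F E_\<iota>] by simp
  then have 1: "ins (\<iota> a) F y w = \<kappa> (snd (ins (\<iota> a) F (\<lambda>i. \<iota> (fst (y i))) (\<iota> (fst w))))" for a y
    by (rule Suc.IH[OF alt_hom_ins[OF F]])
  have "W.weight E q (of_nat 2) (ins (\<kappa> v) F)" for v
    using W.weight_ins[OF Suc.prems(2) F E_\<kappa>] by simp
  then have 2: "ins (\<kappa> v) F y w = 0" for v y
    by (rule weight_ge_2[OF alt_hom_ins[OF F]]) simp
  show ?case
    unfolding cochain_split[OF F, of x w] 2 add_0_right
    by (subst 1) (simp add: ins_def case_nat_\<iota>[of "\<lambda>i. fst (x i)"])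
qed

text \<open>Split the first argument: its \<gg>-part keeps weight 0 and is covered by induction,
  while its \<open>V\<close>-part leads to weight 1 and gives the summand j = 0.\<close>

lemma weight_0_eq:
  assumes "F \<in> W.cochains q" "W.weight E q 0 F"
  shows "F x w = (fst (F (\<lambda>i. \<iota> (fst (x i))) (\<iota> (fst w))),
    snd (F (\<lambda>i. \<iota> (fst (x i))) (\<kappa> (snd w))) +
    (\<Sum>j<q. snd (F ((\<lambda>i. \<iota> (fst (x i)))(j := \<kappa> (snd (x j)))) (\<iota> (fst w)))))"
  using assms
proof (induction q arbitrary: F x)
  case 0
  have "F x = F (\<lambda>i. \<iota> (fst (x i)))" by (rule W.cochains_cong[OF 0(1)]) simp
  then show ?case
    using weight_0_values[OF 0(1), of 0] 0(2) cochain_split_last[OF 0(1), of x w] by (simp add: prod_eq_iff)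
next
  case (Suc q)
  note F = Suc.prems(1)
  let ?x = "\<lambda>i. x (Suc i)"
  have "W.weight E q 0 (ins (\<iota> (fst (x 0))) F)"
    using W.weight_ins[OF Suc.prems(2) F E_\<iota>] by simp
  note 1 = Suc.IH[OF alt_hom_ins[OF F] this, of ?x]
  have "W.weight E q 1 (ins (\<kappa> (snd (x 0))) F)"
    using W.weight_ins[OF Suc.prems(2) F E_\<kappa>] by simp
  note 2 = weight_1_eq[OF alt_hom_ins[OF F] this, of ?x]
  have upd0: "case_nat (\<kappa> v) (\<lambda>i. \<iota> (fst (x (Suc i)))) = (\<lambda>i. \<iota> (fst (x i)))(0 := \<kappa> v)" for v
    by (auto simp: fun_eq_iff split: nat.split)
  have upd: "case_nat (\<iota> (fst (x 0))) ((\<lambda>i. \<iota> (fst (x (Suc i))))(j := u)) = (\<lambda>i. \<iota> (fst (x i)))(Suc j := u)" for j u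
    by (auto simp: fun_eq_iff split: nat.split)
  show ?case
    unfolding cochain_split[OF F, of x w] 1 2 sum.lessThan_Suc_shift
    unfolding ins_def upd0 upd case_nat_\<iota>[of "\<lambda>i. fst (x i)"]
    by (simp add: add_ac)
qed

end

section \<open>The complex\<close>

context pre_LieDer_pair_char_0
begin

definition homogeneous :: "nat \<Rightarrow> 'k \<Rightarrow> ('g \<times> 'v) cochain set" where
  "homogeneous q c = {F \<in> W.cochains q. W.weight E q c F}"

lemma homogeneous_zero: "0 \<in> homogeneous q c"
  by (simp add: homogeneous_def alt_hom_zero_mem vector_space_sW W.weight_zero endo_E)

lemma homogeneous_add: "F \<in> homogeneous q c \<Longrightarrow> G \<in> homogeneous q c \<Longrightarrow> F + G \<in> homogeneous q c"
  by (simp add: homogeneous_def alt_hom_add W.weight_add endo_E)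

lemma homogeneous_scale: "F \<in> homogeneous q c \<Longrightarrow> (\<lambda>x w. sW r (F x w)) \<in> homogeneous q c"
  by (simp add: homogeneous_def alt_hom_scale vector_space_sW W.weight_scale endo_E)

lemma homogeneous_cobd: "F \<in> homogeneous q c \<Longrightarrow> W.cobd q F \<in> homogeneous (Suc q) c"
  by (simp add: homogeneous_def W.cobd_mem W.weight_cobd[OF endo_E derivation_E])

lemma homogeneous_lift_gV: "f \<in> alt_hom q sg sg sv \<Longrightarrow> lift_gV f \<in> homogeneous q 1"
  by (simp add: homogeneous_def lift_gV_mem)

lemma homogeneous_1_lift:
  assumes F: "F \<in> homogeneous q 1"
  obtains f where "f \<in> alt_hom q sg sg sv" "F = lift_gV f"
proof
  let ?f = "\<lambda>x y. snd (F (\<lambda>i. \<iota> (x i)) (\<iota> y))"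
  have F': "F \<in> W.cochains q" "W.weight E q 1 F" using F by (simp_all add: homogeneous_def)
  show "?f \<in> alt_hom q sg sg sv"
    by (rule alt_hom_comp[OF F'(1) linear_\<iota> linear_\<iota> linear_snd])
  show "F = lift_gV ?f"
    by (intro ext, subst weight_1_eq[OF F']) (simp add: lift_gV_def)
qed

lemma lift_mu_0: "lift_mu sv n 0 = 0"
  by (simp add: lift_mu_def fun_eq_iff zero_prod_def)

lemma move_to_end:
  assumes F: "F \<in> W.cochains (Suc k)" and "i \<le> k"
  shows "F ((\<lambda>j. y (skip i j))(k := u)) w = sW ((-1) ^ (i + k)) (F (y(i := u)) w)"
proof -
  have "F ((\<lambda>j. y (skip i j))(k := u)) = F (\<lambda>j. (y(i := u)) (to_place k i j))"
    using skip_neq by (intro W.cochains_cong[OF F]) (auto simp: to_place_def)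
  moreover have "to_place k i permutes {..<Suc k}"
    using permutes_to_place[OF \<open>i \<le> k\<close>] by (simp only: lessThan_Suc_atMost)
  ultimately show ?thesis
    using alt_hom_permute[OF F, of "to_place k i" "y(i := u)" w] by (simp add: sign_to_place \<open>i \<le> k\<close>)
qed

text \<open>The components are read off from \<open>weight_0_eq\<close>; what needs proof is that
  the signs in \<open>lift_mu\<close> are those of reordering the arguments.\<close>

lemma homogeneous_0_lift:
  assumes F: "F \<in> homogeneous (Suc k) 0"
  obtains fg f\<rho> f\<mu> where "fg \<in> alt_hom (Suc k) sg sg sg" "f\<rho> \<in> alt_hom (Suc k) sg sv sv"
    "f\<mu> \<in> alt_hom2 k sg sv sg sv" "F = lift_g fg + lift_rho f\<rho> + lift_mu sv (Suc (Suc k)) f\<mu>"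
proof
  let ?fg = "\<lambda>x y. fst (F (\<lambda>i. \<iota> (x i)) (\<iota> y))"
  let ?f\<rho> = "\<lambda>x v. snd (F (\<lambda>i. \<iota> (x i)) (\<kappa> v))"
  \<comment> \<open>The argument from \<open>V\<close> goes into the last alternating slot, where
    \<open>lift_mu\<close> has the sign +1.\<close>
  let ?f\<mu> = "\<lambda>x v y. snd (F ((\<lambda>i. \<iota> (x i))(k := \<kappa> v)) (\<iota> y))"
  have F': "F \<in> W.cochains (Suc k)" "W.weight E (Suc k) 0 F" using F by (simp_all add: homogeneous_def)
  show "?fg \<in> alt_hom (Suc k) sg sg sg"
    by (rule alt_hom_comp[OF F'(1) linear_\<iota> linear_\<iota> linear_fst])
  show "?f\<rho> \<in> alt_hom (Suc k) sg sv sv"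
    by (rule alt_hom_comp[OF F'(1) linear_\<iota> linear_\<kappa> linear_snd])
  have "(\<lambda>x y. ?f\<mu> x v y) \<in> alt_hom k sg sg sv" for v
    by (rule alt_hom_comp[OF alt_hom_fix_last[OF F'(1)] linear_\<iota> linear_\<iota> linear_snd])
  moreover have "Vector_Spaces.linear sv sv (\<lambda>v. ?f\<mu> x v y)" for x y
    by (rule linear_comp[OF linear_comp[OF linear_\<kappa> alt_hom_slot_linear[OF F'(1)]] linear_snd]) simp
  ultimately show "?f\<mu> \<in> alt_hom2 k sg sv sg sv" by (simp add: alt_hom2_def)
  show "F = lift_g ?fg + lift_rho ?f\<rho> + lift_mu sv (Suc (Suc k)) ?f\<mu>"
  proof (intro ext)
    fix x :: "nat \<Rightarrow> 'g \<times> 'v" and w :: "'g \<times> 'v"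
    have "sv ((-1) ^ (k - i)) (snd (F ((\<lambda>j. \<iota> (fst (x (skip i j))))(k := \<kappa> (snd (x i)))) (\<iota> (fst w)))) =
        snd (F ((\<lambda>j. \<iota> (fst (x j)))(i := \<kappa> (snd (x i)))) (\<iota> (fst w)))" if "i \<le> k" for i
    proof -
      \<comment> \<open>The sign of the lift and the sign of \<open>move_to_end\<close> multiply to
        an even power.\<close>
      have "(-1 :: 'k) ^ (k - i) * (-1) ^ (i + k) = (-1) ^ (2 * k)"
        unfolding power_add[symmetric] using that by (simp add: mult_2)
      then show ?thesis
        unfolding move_to_end[OF F'(1) that, of "\<lambda>j. \<iota> (fst (x j))"]
        by (simp add: sW_eq)
    qed
    then have mu: "lift_mu sv (Suc (Suc k)) ?f\<mu> x w =
        (0, \<Sum>j<Suc k. snd (F ((\<lambda>i. \<iota> (fst (x i)))(j := \<kappa> (snd (x j)))) (\<iota> (fst w))))"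
      unfolding insert_alternating_eq_lift_mu insert_alternating_def lessThan_Suc_atMost fst_conv snd_conv
      by (intro arg_cong[where f = "Pair 0"] sum.cong refl) auto
    show "F x w = (lift_g ?fg + lift_rho ?f\<rho> + lift_mu sv (Suc (Suc k)) ?f\<mu>) x w"
      unfolding plus_fun_apply mu
      by (subst weight_0_eq[OF F']) (simp add: lift_g_def lift_rho_def del: sum.lessThan_Suc)
  qed
qed

lemma homogeneous_0_0_lift:
  assumes F: "F \<in> homogeneous 0 0"
  obtains fg f\<rho> where "fg \<in> alt_hom 0 sg sg sg" "f\<rho> \<in> alt_hom 0 sg sv sv" "F = lift_g fg + lift_rho f\<rho>"
proof
  let ?fg = "\<lambda>x y. fst (F (\<lambda>i. \<iota> (x i)) (\<iota> y))"
  let ?f\<rho> = "\<lambda>x v. snd (F (\<lambda>i. \<iota> (x i)) (\<kappa> v))"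
  have F': "F \<in> W.cochains 0" "W.weight E 0 0 F" using F by (simp_all add: homogeneous_def)
  show "?fg \<in> alt_hom 0 sg sg sg"
    by (rule alt_hom_comp[OF F'(1) linear_\<iota> linear_\<iota> linear_fst])
  show "?f\<rho> \<in> alt_hom 0 sg sv sv"
    by (rule alt_hom_comp[OF F'(1) linear_\<iota> linear_\<kappa> linear_snd])
  show "F = lift_g ?fg + lift_rho ?f\<rho>"
    by (intro ext, subst weight_0_eq[OF F']) (simp add: lift_g_def lift_rho_def)
qed

section \<open>The cochain spaces in terms of weights\<close>

lemma cochain_space_0: "cochain_space sg sv 0 = {0}"
proof -
  have "lift_g 0 = (0 :: ('g \<times> 'v) cochain)" "lift_rho 0 = (0 :: ('g \<times> 'v) cochain)"
    "lift_gV 0 = (0 :: ('g \<times> 'v) cochain)"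
    by (simp_all add: lift_g_def lift_rho_def lift_gV_def fun_eq_iff zero_prod_def)
  then show ?thesis
    by (simp add: cochain_space_def cochain_components_def lift_cochain_def lift_mu_0 zero_prod_def)
qed

lemma cochain_space_1: "cochain_space sg sv (Suc 0) = homogeneous 0 0 \<times> {0 :: ('g \<times> 'v) cochain}"
proof -
  have gV: "lift_gV 0 = (0 :: ('g \<times> 'v) cochain)"
    by (simp add: lift_gV_def fun_eq_iff zero_prod_def)
  show ?thesis
  proof (intro equalityI subsetI)
    fix c assume "c \<in> cochain_space sg sv (Suc 0)"
    then obtain fg f\<rho> where f: "fg \<in> alt_hom 0 sg sg sg" "f\<rho> \<in> alt_hom 0 sg sv sv"
      and c: "c = (lift_g fg + lift_rho f\<rho>, 0)"
      by (auto simp: cochain_space_def cochain_components_def lift_cochain_def lift_mu_0 gV)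
    show "c \<in> homogeneous 0 0 \<times> {0}"
      unfolding c using lift_g_mem[OF f(1)] lift_rho_mem[OF f(2)]
      by (auto intro!: homogeneous_add simp: homogeneous_def[of 0 0] alt_hom_add W.weight_add endo_E)
  next
    fix c assume "c \<in> homogeneous 0 0 \<times> {0 :: ('g \<times> 'v) cochain}"
    then obtain F where c: "c = (F, 0)" and F: "F \<in> homogeneous 0 0" by auto
    obtain fg f\<rho> where f: "fg \<in> alt_hom 0 sg sg sg" "f\<rho> \<in> alt_hom 0 sg sv sv" "F = lift_g fg + lift_rho f\<rho>"
      using homogeneous_0_0_lift[OF F] .
    have "c = lift_cochain sv (Suc 0) (fg, f\<rho>, 0, 0)"
      by (simp add: lift_cochain_def lift_mu_0 gV c f(3))
    moreover have "(fg, f\<rho>, 0, 0) \<in> cochain_components sg sv (Suc 0)"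
      using f by (simp add: cochain_components_def)
    ultimately show "c \<in> cochain_space sg sv (Suc 0)" unfolding cochain_space_def by blast
  qed
qed

text \<open>In this form, preservation of the cochain spaces is a matter of degrees and weights
  alone.\<close>

lemma cochain_space_Suc_Suc:
  "cochain_space sg sv (Suc (Suc k)) = homogeneous (Suc k) 0 \<times> homogeneous k 1"
proof (intro equalityI subsetI)
  fix c assume "c \<in> cochain_space sg sv (Suc (Suc k))"
  then obtain fg f\<rho> f\<mu> \<theta> where f: "fg \<in> alt_hom (Suc k) sg sg sg" "f\<rho> \<in> alt_hom (Suc k) sg sv sv"
      "f\<mu> \<in> alt_hom2 k sg sv sg sv" "\<theta> \<in> alt_hom k sg sg sv"
    and c: "c = (lift_g fg + lift_rho f\<rho> + lift_mu sv (Suc (Suc k)) f\<mu>, lift_gV \<theta>)"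
    by (auto simp: cochain_space_def cochain_components_def lift_cochain_def)
  have "lift_g fg \<in> homogeneous (Suc k) 0" "lift_rho f\<rho> \<in> homogeneous (Suc k) 0"
    "lift_mu sv (Suc (Suc k)) f\<mu> \<in> homogeneous (Suc k) 0"
    using lift_g_mem[OF f(1)] lift_rho_mem[OF f(2)] lift_mu_mem[OF f(3)]
    by (simp_all add: homogeneous_def)
  then show "c \<in> homogeneous (Suc k) 0 \<times> homogeneous k 1"
    unfolding c by (intro SigmaI homogeneous_add homogeneous_lift_gV f(4))
next
  fix c assume "c \<in> homogeneous (Suc k) 0 \<times> homogeneous k 1"
  then obtain F \<Theta> where c: "c = (F, \<Theta>)" and F: "F \<in> homogeneous (Suc k) 0" "\<Theta> \<in> homogeneous k 1" by auto
  obtain fg f\<rho> f\<mu> where f: "fg \<in> alt_hom (Suc k) sg sg sg" "f\<rho> \<in> alt_hom (Suc k) sg sv sv"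
      "f\<mu> \<in> alt_hom2 k sg sv sg sv" "F = lift_g fg + lift_rho f\<rho> + lift_mu sv (Suc (Suc k)) f\<mu>"
    using homogeneous_0_lift[OF F(1)] .
  obtain \<theta> where \<theta>: "\<theta> \<in> alt_hom k sg sg sv" "\<Theta> = lift_gV \<theta>"
    using homogeneous_1_lift[OF F(2)] .
  have "c = lift_cochain sv (Suc (Suc k)) (fg, f\<rho>, f\<mu>, \<theta>)"
    by (simp add: lift_cochain_def c f(4) \<theta>(2))
  moreover have "(fg, f\<rho>, f\<mu>, \<theta>) \<in> cochain_components sg sv (Suc (Suc k))"
    using f \<theta> by (simp add: cochain_components_def)
  ultimately show "c \<in> cochain_space sg sv (Suc (Suc k))" unfolding cochain_space_def by blast
qed

section \<open>The coboundary in terms of d and L_D\<close>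

lemma total_structure_eq: "total_structure sv prd \<rho> \<mu> = (\<lambda>x w. semidirect (x 0) w)"
  by (intro ext)
    (simp add: total_structure_def lift_g_def lift_rho_def lift_mu_def semidirect_def)

lemma lift_gV_D: "lift_gV (\<lambda>_. D) = (\<lambda>_. D')"
  by (intro ext) (simp add: lift_gV_def D'_def)

abbreviation lie_D :: "nat \<Rightarrow> ('g \<times> 'v) cochain \<Rightarrow> ('g \<times> 'v) cochain" where
  "lie_D q \<equiv> lie q D' (W.derivation_action D')"

lemma cochain_scale_eq:
  "cochain_scale sg sv a c = (\<lambda>x w. sW a (fst c x w), \<lambda>x w. sW a (snd c x w))"
  by (simp add: cochain_scale_def split_beta)

text \<open>The exponent is negative for n < 2, but only its parity matters.\<close>

lemma minus_one_powi: "(-1 :: 'k) powi (int n - 2) = (-1) ^ n"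
  by (simp add: power_int_diff)

lemma sW_minus_one_power: "sW ((-1) ^ n) (sW ((-1) ^ n) v) = v"
  by (rule W.scale_minus_one_power)

lemma coboundary_0: "coboundary sg sv prd \<rho> \<mu> D 0 0 = 0"
proof -
  have 0: "(0 :: ('g \<times> 'v) cochain) \<in> W.cochains 0"
    by (simp add: alt_hom_zero_mem vector_space_sW)
  have "MN_bracket sW 1 0 (\<lambda>x w. semidirect (x 0) w) 0 = 0"
    unfolding W.MN_bracket_product[OF 0] W.cobd_zero by (simp add: fun_eq_iff)
  moreover have "MN_bracket sW 0 0 0 (\<lambda>_. D') = 0"
    unfolding W.MN_bracket_endo[OF 0] W.lie_zero[OF W.operator_derivation_action[OF endo_D']]
    by (rule minus_zero)
  ultimately show ?thesis
    unfolding coboundary_def zero_prod_def case_prod_conv Let_def total_structure_eq lift_gV_D diff_0_eq_0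
    by (simp only: cochain_scale_eq fst_conv snd_conv) (simp add: fun_eq_iff)
qed

text \<open>The prefactor is (-1)^(q+1). It meets -(-1)^q in the first component and -1 before L_D.
  The exponent before d \<Theta> stays unsimplified because q - 1 is truncated at q = 0; for q > 0
  it is even.\<close>

lemma coboundary_eq:
  assumes F: "F \<in> W.cochains q" and \<Theta>: "\<Theta> \<in> W.cochains (q - 1)"
  shows "coboundary sg sv prd \<rho> \<mu> D (Suc q) (F, \<Theta>) =
    (W.cobd q F, (\<lambda>x w. sW ((-1) ^ (Suc q + (q - 1))) (W.cobd (q - 1) \<Theta> x w)) +
       (\<lambda>x w. sW ((-1) ^ q) (lie_D q F x w)))"
proof -
  have 1: "MN_bracket sW 1 q (\<lambda>x w. semidirect (x 0) w) F = (\<lambda>x w. sW ((-1) ^ q) (W.cobd q F x w))"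
    by (rule W.MN_bracket_product[OF F])
  have 2: "MN_bracket sW 1 (q - 1) (\<lambda>x w. semidirect (x 0) w) \<Theta> =
      (\<lambda>x w. sW ((-1) ^ (q - 1)) (W.cobd (q - 1) \<Theta> x w))"
    by (rule W.MN_bracket_product[OF \<Theta>])
  have 3: "MN_bracket sW q 0 F (\<lambda>_. D') = - lie_D q F"
    by (rule W.MN_bracket_endo[OF F])
  have q: "Suc q - 1 = q" "Suc q - 2 = q - 1" by auto
  show ?thesis
    unfolding coboundary_def case_prod_conv Let_def total_structure_eq lift_gV_D q 1 2 3
      minus_one_powi cochain_scale_eq fst_conv snd_conv
    by (auto simp: fun_eq_iff W.scale_right_diff_distrib power_add sW_minus_one_power mult.commute
        simp flip: W.scale_scale)
qed

lemma coboundary_1: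
  assumes "F \<in> W.cochains 0"
  shows "coboundary sg sv prd \<rho> \<mu> D (Suc 0) (F, 0) = (W.cobd 0 F, lie_D 0 F)"
proof -
  have "(0 :: ('g \<times> 'v) cochain) \<in> W.cochains 0"
    by (simp add: alt_hom_zero_mem vector_space_sW)
  then show ?thesis
    using coboundary_eq[OF assms, of 0] by (simp add: W.cobd_zero fun_eq_iff)
qed

lemma coboundary_Suc_Suc:
  assumes "F \<in> W.cochains (Suc k)" "\<Theta> \<in> W.cochains k"
  shows "coboundary sg sv prd \<rho> \<mu> D (Suc (Suc k)) (F, \<Theta>) =
    (W.cobd (Suc k) F, W.cobd k \<Theta> + (\<lambda>x w. sW ((-1) ^ Suc k) (lie_D (Suc k) F x w)))"
proof -
  have "(-1 :: 'k) ^ (Suc (Suc k) + (Suc k - 1)) = 1" by (simp flip: mult_2)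
  with coboundary_eq[OF assms(1), of \<Theta>] assms(2) show ?thesis by (simp del: power_Suc)
qed

lemma homogeneous_lie_D: "F \<in> homogeneous q 0 \<Longrightarrow> lie_D q F \<in> homogeneous q 1"
  by (simp add: homogeneous_def W.lie_mem[OF endo_D' W.operator_derivation_action[OF endo_D']]
      W.weight_lie[OF endo_E endo_D' _ _ commutator_E_D'])

lemmas lie_D_linear = W.lie_add[OF W.operator_derivation_action[OF endo_D']]
  W.lie_scale[OF W.operator_derivation_action[OF endo_D']]
  W.lie_zero[OF W.operator_derivation_action[OF endo_D']]

lemma homogeneous_cochains: "F \<in> homogeneous q c \<Longrightarrow> F \<in> W.cochains q"
  by (simp add: homogeneous_def)

lemma cochain_cases:
  assumes "c \<in> cochain_space sg sv n"
  obtains (0) "n = 0" "c = 0"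
    | (1) F where "n = Suc 0" "c = (F, 0)" "F \<in> homogeneous 0 0"
    | (2) k F \<Theta> where "n = Suc (Suc k)" "c = (F, \<Theta>)" "F \<in> homogeneous (Suc k) 0" "\<Theta> \<in> homogeneous k 1"
proof (cases n)
  case 0
  with assms that(1) show ?thesis by (simp add: cochain_space_0)
next
  case (Suc m)
  then show ?thesis
    using assms that(2,3) by (cases m) (auto simp: cochain_space_1 cochain_space_Suc_Suc)
qed

section \<open>Verification of the complex\<close>

lemma vector_space_cochain_scale: "vector_space (cochain_scale sg sv)"
  by unfold_locales
    (simp_all add: cochain_scale_eq prod_eq_iff fun_eq_iff W.scale_right_distrib W.scale_left_distrib)

lemma subspace_cochain_space: "module.subspace (cochain_scale sg sv) (cochain_space sg sv n)"
proof -
  interpret S: vector_space "cochain_scale sg sv" by (rule vector_space_cochain_scale)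
  have 0: "(\<lambda>x w. 0) = (0 :: ('g \<times> 'v) cochain)" by (simp add: fun_eq_iff)
  consider "n = 0" | "n = Suc 0" | k where "n = Suc (Suc k)" by (metis not0_implies_Suc)
  then show ?thesis
    by cases (auto simp: S.subspace_single_0 S.subspace_def[of "_ \<times> _"] cochain_space_0 cochain_space_1 cochain_space_Suc_Suc
        homogeneous_zero homogeneous_add homogeneous_scale mem_Times_iff
        cochain_scale_eq 0)
qed

text \<open>d preserves weights, and L_D takes weight 0 to weight 1, the weight of the second
  component.\<close>

lemma coboundary_mem:
  assumes "c \<in> cochain_space sg sv n"
  shows "coboundary sg sv prd \<rho> \<mu> D n c \<in> cochain_space sg sv (Suc n)"
  using assms
proof (cases rule: cochain_cases)
  case 0
  show ?thesis
    unfolding 0 coboundary_0 cochain_space_1 by (simp add: mem_Times_iff homogeneous_zero)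
next
  case (1 F)
  then show ?thesis
    by (simp add: coboundary_1 homogeneous_cochains cochain_space_Suc_Suc homogeneous_cobd homogeneous_lie_D)
next
  case (2 k F \<Theta>)
  then show ?thesis
    by (simp add: coboundary_Suc_Suc homogeneous_cochains cochain_space_Suc_Suc homogeneous_add
        homogeneous_cobd homogeneous_scale homogeneous_lie_D del: power_Suc W.cobd.simps)
qed

lemma coboundary_add:
  assumes "c \<in> cochain_space sg sv n" "c' \<in> cochain_space sg sv n"
  shows "coboundary sg sv prd \<rho> \<mu> D n (c + c') =
    coboundary sg sv prd \<rho> \<mu> D n c + coboundary sg sv prd \<rho> \<mu> D n c'"
  using assms(1)
proof (cases rule: cochain_cases)
  case 0
  then show ?thesis using assms(2) by (simp add: cochain_space_0 coboundary_0)
next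
  case (1 F)
  then obtain F' where c': "c' = (F', 0)" "F' \<in> homogeneous 0 0"
    using assms(2) by (auto simp: cochain_space_1)
  have "F + F' \<in> homogeneous 0 0" using 1 c' by (simp add: homogeneous_add)
  then show ?thesis
    using 1(3) c'(2) unfolding 1(1,2) c'(1) add_Pair add_0_left
    by (simp only: coboundary_1 homogeneous_cochains W.cobd_add lie_D_linear add_Pair)
next
  case (2 k F \<Theta>)
  then obtain F' \<Theta>' where c': "c' = (F', \<Theta>')" "F' \<in> homogeneous (Suc k) 0" "\<Theta>' \<in> homogeneous k 1"
    using assms(2) by (auto simp: cochain_space_Suc_Suc)
  have "F + F' \<in> homogeneous (Suc k) 0" "\<Theta> + \<Theta>' \<in> homogeneous k 1"
    using 2 c' by (simp_all add: homogeneous_add)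
  then show ?thesis
    using 2(3,4) c'(2,3) unfolding 2(1,2) c'(1) add_Pair
    by (simp only: coboundary_Suc_Suc homogeneous_cochains W.cobd_add lie_D_linear add_Pair prod.inject)
      (simp add: fun_eq_iff W.scale_right_distrib del: power_Suc W.cobd.simps)
qed

lemma coboundary_scale:
  assumes "c \<in> cochain_space sg sv n"
  shows "coboundary sg sv prd \<rho> \<mu> D n (cochain_scale sg sv a c) =
    cochain_scale sg sv a (coboundary sg sv prd \<rho> \<mu> D n c)"
  using assms
proof (cases rule: cochain_cases)
  case 0
  interpret S: vector_space "cochain_scale sg sv" by (rule vector_space_cochain_scale)
  from 0 show ?thesis by (simp add: coboundary_0)
next
  case (1 F)
  have F: "(\<lambda>x w. sW a (F x w)) \<in> homogeneous 0 0" using 1 by (simp add: homogeneous_scale)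
  have *: "(\<lambda>x w. sW a ((0 :: ('g \<times> 'v) cochain) x w)) = 0" by (simp add: fun_eq_iff)
  show ?thesis
    unfolding 1(1,2) cochain_scale_eq fst_conv snd_conv *
      coboundary_1[OF homogeneous_cochains[OF F]] coboundary_1[OF homogeneous_cochains[OF 1(3)]]
      W.cobd_scale lie_D_linear by (rule refl)
next
  case (2 k F \<Theta>)
  have F: "(\<lambda>x w. sW a (F x w)) \<in> homogeneous (Suc k) 0" "(\<lambda>x w. sW a (\<Theta> x w)) \<in> homogeneous k 1"
    using 2 by (simp_all add: homogeneous_scale)
  show ?thesis
    unfolding 2(1,2) cochain_scale_eq fst_conv snd_conv
    unfolding coboundary_Suc_Suc[OF homogeneous_cochains[OF F(1)] homogeneous_cochains[OF F(2)]]
      coboundary_Suc_Suc[OF homogeneous_cochains[OF 2(3)] homogeneous_cochains[OF 2(4)]]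
      W.cobd_scale lie_D_linear fst_conv snd_conv
    by (simp add: fun_eq_iff W.scale_right_distrib mult.commute del: power_Suc W.cobd.simps)
qed

text \<open>Beyond d d = 0, only d L_D f and L_D d f remain in the second component. They are equal
  and come with the signs of consecutive degrees, hence cancel.\<close>

lemma coboundary_coboundary:
  assumes "c \<in> cochain_space sg sv n"
  shows "coboundary sg sv prd \<rho> \<mu> D (Suc n) (coboundary sg sv prd \<rho> \<mu> D n c) = 0"
  using assms
proof (cases rule: cochain_cases)
  case 0
  have "(0 :: ('g \<times> 'v) cochain) \<in> W.cochains 0"
    by (rule homogeneous_cochains[OF homogeneous_zero])
  with 0 show ?thesis
    by (simp only: coboundary_0) (simp only: zero_prod_def coboundary_1 W.cobd_zero lie_D_linear)
next
  case (1 F)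
  note F = homogeneous_cochains[OF 1(3)]
  have "W.cobd 0 F \<in> W.cochains (Suc 0)" "lie_D 0 F \<in> W.cochains 0"
    using homogeneous_cobd[OF 1(3)] homogeneous_lie_D[OF 1(3)] by (simp_all add: homogeneous_cochains)
  moreover have "W.cobd (Suc 0) (W.cobd 0 F) = 0" by (rule W.cobd_cobd[OF F])
  moreover have "lie_D (Suc 0) (W.cobd 0 F) = W.cobd 0 (lie_D 0 F)"
    by (rule W.cobd_lie_derivation[OF endo_D' derivation_D' F])
  ultimately show ?thesis
    unfolding 1(1,2) coboundary_1[OF F]
    by (simp only: coboundary_Suc_Suc) (simp add: prod_eq_iff fun_eq_iff del: W.cobd.simps)
next
  case (2 k F \<Theta>)
  note F = homogeneous_cochains[OF 2(3)] and \<Theta> = homogeneous_cochains[OF 2(4)]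
  let ?L = "\<lambda>x w. sW ((-1) ^ Suc k) (lie_D (Suc k) F x w)"
  have mem: "W.cobd (Suc k) F \<in> W.cochains (Suc (Suc k))" "W.cobd k \<Theta> + ?L \<in> W.cochains (Suc k)"
    using homogeneous_cochains[OF homogeneous_cobd[OF 2(3)]]
      homogeneous_cochains[OF homogeneous_add[OF homogeneous_cobd[OF 2(4)]
        homogeneous_scale[OF homogeneous_lie_D[OF 2(3)]]]] by blast+
  have "W.cobd (Suc k) (W.cobd k \<Theta> + ?L) =
      (\<lambda>x w. sW ((-1) ^ Suc k) (W.cobd (Suc k) (lie_D (Suc k) F) x w))"
    by (simp only: W.cobd_add W.cobd_cobd[OF \<Theta>] W.cobd_scale add_0_left)
  then show ?thesis
    unfolding 2(1,2) coboundary_Suc_Suc[OF F \<Theta>] coboundary_Suc_Suc[OF mem]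
      W.cobd_cobd[OF F] W.cobd_lie_derivation[OF endo_D' derivation_D' F]
    by (simp add: prod_eq_iff fun_eq_iff del: W.cobd.simps)
qed

lemma cochain_complex_coboundary:
  "cochain_complex (cochain_scale sg sv) (cochain_space sg sv) (coboundary sg sv prd \<rho> \<mu> D)"
  unfolding cochain_complex_def
  using vector_space_cochain_scale subspace_cochain_space coboundary_mem coboundary_add
    coboundary_scale coboundary_coboundary by (blast intro: image_subsetI)

end

theorem theorem4p1:
  fixes sg :: "'k::{alg_closed_field, field_char_0} \<Rightarrow> 'g::ab_group_add \<Rightarrow> 'g"
    and sv :: "'k \<Rightarrow> 'v::ab_group_add \<Rightarrow> 'v"
    and prd :: "'g \<Rightarrow> 'g \<Rightarrow> 'g"
    and \<rho> \<mu> :: "'g \<Rightarrow> 'v \<Rightarrow> 'v"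
    and D :: "'g \<Rightarrow> 'v"
  assumes "pre_LieDer_pair sg prd sv \<rho> \<mu> D"
  shows "cochain_complex (cochain_scale sg sv) (cochain_space sg sv)
    (coboundary sg sv prd \<rho> \<mu> D)"
proof -
  interpret pre_LieDer_pair_char_0 sg prd sv \<rho> \<mu> D
    using assms by (rule pre_LieDer_pair_char_0.intro)
  show ?thesis by (rule cochain_complex_coboundary)
qed

end
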